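(* Let $\mathcal T$ be a compactly generated triangulated category with shift $\Sigma$, and let $f:A\to B$ and $f':A\to B'$ be morphisms in $\mathcal T^{\rm c}$. The (typical pp) formula $$\exists\, x_{B'}\,(x_B f = x_{B'}f')$$ (with free variable $x_B$ of sort $B$) is equivalent on $\mathcal T$ to the divisibility formula $g\mid x_B$, where $g:B\to C$ is as in a distinguished triangle $$A\xrightarrow{\left(\begin{smallmatrix} f\\ f'\end{smallmatrix}\right)} B\oplus B'\xrightarrow{(g,\,g')} C\to \Sigma A,$$ and hence is also equivalent on $\mathcal T$ to the annihilation formula $x_B f''=0$, where $$A'\xrightarrow{f''} B\xrightarrow{g} C\to\Sigma A'$$ is a distinguished triangle.
   Context: $\mathcal T$ is a triangulated category with arbitrary coproducts. An object $A$ is compact if $\mathrm{Hom}(A,-)$ commutes with coproducts; $\mathcal T^{\rm c}$ is the full subcategory of compact objects. Compactly generated means that $\mathcal T^{\rm c}$ has only a set of isomorphism classes and that $\mathrm{Hom}(A,X)=0$ for all compact $A$ implies $X=0$. We write $(X,Y)=\mathrm{Hom}_{\mathcal T}(X,Y)$. Language for $\mathcal T$: there is one sort for each object $A$ of (a small version of) $\mathcal T^{\rm c}$. For $X\in\mathcal T$, the elements of $X$ of sort $A$ are the morphisms $A\to X$. The language has addition and zero on each sort and, for each $f:A\to B$ in $\mathcal T^{\rm c}$, a function symbol from sort $B$ to sort $A$ interpreted in $X$ by $b\mapsto bf$ (composition of $f$ followed by $b:B\to X$). A pp formula is one obtained from a finite system of linear equations (with coefficients morphisms of $\mathcal T^{\rm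 c}$) by existentially quantifying some variables. For $g:B\to C$ in $\mathcal T^{\rm c}$, $g\mid x_B$ denotes $\exists y_C\,(x_B=y_C g)$. Two formulas in the same free variables are equivalent on $\mathcal T$ if they have the same solution set in every $X\in\mathcal T$. *)

theory Defs
  imports "HOL-Algebra.Product_Groups" "HOL-Algebra.Free_Abelian_Groups"
    "HOL-Library.Equipollence"
begin

section \<open>Categories, preadditive and additive categories\<close>

record ('o, 'm) category =
  Obj :: "'o set"
  Arr :: "'m set"
  Dom :: "'m \<Rightarrow> 'o"
  Cod :: "'m \<Rightarrow> 'o"
  ident :: "'o \<Rightarrow> 'm"
  cmp :: "'m \<Rightarrow> 'm \<Rightarrow> 'm" (infixr \<open>\<cdot>\<index>\<close> 70)
  \<comment> \<open>\<open>g \<cdot> f\<close> is \<open>f\<close> followed by \<open>g\<close>\<close>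

record ('o, 'm) preadditive_category = "('o, 'm) category" +
  add_arr :: "'m \<Rightarrow> 'm \<Rightarrow> 'm" (infixl \<open>\<boxplus>\<index>\<close> 65)
  zero_arr :: "'o \<Rightarrow> 'o \<Rightarrow> 'm"

record ('o, 'm) triangulated_category = "('o, 'm) preadditive_category" +
  shift_obj :: "'o \<Rightarrow> 'o"
  shift_arr :: "'m \<Rightarrow> 'm"
  triangles :: "('m \<times> 'm \<times> 'm) set"

definition Hom :: "('o, 'm, 'z) category_scheme \<Rightarrow> 'o \<Rightarrow> 'o \<Rightarrow> 'm set" where
  "Hom T A B = {f \<in> Arr T. Dom T f = A \<and> Cod T f = B}"

definition iso_arr :: "('o, 'm, 'z) category_scheme \<Rightarrow> 'm \<Rightarrow> bool" where
  "iso_arr T f \<longleftrightarrow> f \<in> Arr T \<and>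
     (\<exists>g \<in> Hom T (Cod T f) (Dom T f).
        g \<cdot>\<^bsub>T\<^esub> f = ident T (Dom T f) \<and> f \<cdot>\<^bsub>T\<^esub> g = ident T (Cod T f))"

definition iso_obj :: "('o, 'm, 'z) category_scheme \<Rightarrow> 'o \<Rightarrow> 'o \<Rightarrow> bool" where
  "iso_obj T A B \<longleftrightarrow> (\<exists>f \<in> Hom T A B. iso_arr T f)"

definition zero_object :: "('o, 'm, 'z) category_scheme \<Rightarrow> 'o \<Rightarrow> bool" where
  "zero_object T Z \<longleftrightarrow> Z \<in> Obj T \<and>
     (\<forall>A \<in> Obj T. (\<exists>!f. f \<in> Hom T Z A) \<and> (\<exists>!f. f \<in> Hom T A Z))"

definition is_coproduct ::
  "('o, 'm, 'z) category_scheme \<Rightarrow> 'i set \<Rightarrow> ('i \<Rightarrow> 'o) \<Rightarrow> 'o \<Rightarrow> ('i \<Rightarrow> 'm) \<Rightarrow> bool" where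
  "is_coproduct T I X P \<iota> \<longleftrightarrow>
     X \<in> I \<rightarrow> Obj T \<and> P \<in> Obj T \<and> (\<forall>i\<in>I. \<iota> i \<in> Hom T (X i) P) \<and>
     (\<forall>Y \<in> Obj T. \<forall>h. (\<forall>i\<in>I. h i \<in> Hom T (X i) Y) \<longrightarrow>
        (\<exists>!k. k \<in> Hom T P Y \<and> (\<forall>i\<in>I. k \<cdot>\<^bsub>T\<^esub> \<iota> i = h i)))"

locale category =
  fixes T :: "('o, 'm, 'z) category_scheme" (structure)
  assumes arr_ends: "f \<in> Arr T \<Longrightarrow> Dom T f \<in> Obj T \<and> Cod T f \<in> Obj T"
    and ident_Hom: "A \<in> Obj T \<Longrightarrow> ident T A \<in> Hom T A A"
    and cmp_Hom: "\<lbrakk>f \<in> Hom T A B; g \<in> Hom T B C\<rbrakk> \<Longrightarrow> g \<cdot> f \<in> Hom T A C"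
    and cmp_ident_right: "f \<in> Hom T A B \<Longrightarrow> f \<cdot> ident T A = f"
    and cmp_ident_left: "f \<in> Hom T A B \<Longrightarrow> ident T B \<cdot> f = f"
    and cmp_assoc: "\<lbrakk>f \<in> Hom T A B; g \<in> Hom T B C; h \<in> Hom T C D\<rbrakk>
          \<Longrightarrow> (h \<cdot> g) \<cdot> f = h \<cdot> (g \<cdot> f)"

definition hom_group ::
  "('o, 'm, 'z) preadditive_category_scheme \<Rightarrow> 'o \<Rightarrow> 'o \<Rightarrow> 'm monoid" where
  "hom_group T A B = \<lparr>carrier = Hom T A B, mult = add_arr T, one = zero_arr T A B\<rparr>"

definition neg_arr :: "('o, 'm, 'z) preadditive_category_scheme \<Rightarrow> 'm \<Rightarrow> 'm" where
  "neg_arr T f = inv\<^bsub>hom_group T (Dom T f) (Cod T f)\<^esub> f"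

definition is_biproduct ::
  "('o, 'm, 'z) preadditive_category_scheme \<Rightarrow> 'o \<Rightarrow> 'o \<Rightarrow> 'o \<Rightarrow> 'm \<Rightarrow> 'm \<Rightarrow> 'm \<Rightarrow> 'm \<Rightarrow> bool"
  where
  "is_biproduct T B B' P i i' p p' \<longleftrightarrow>
     i \<in> Hom T B P \<and> i' \<in> Hom T B' P \<and> p \<in> Hom T P B \<and> p' \<in> Hom T P B' \<and>
     p \<cdot>\<^bsub>T\<^esub> i = ident T B \<and> p' \<cdot>\<^bsub>T\<^esub> i' = ident T B' \<and>
     p \<cdot>\<^bsub>T\<^esub> i' = zero_arr T B' B \<and> p' \<cdot>\<^bsub>T\<^esub> i = zero_arr T B B' \<and>
     (i \<cdot>\<^bsub>T\<^esub> p) \<boxplus>\<^bsub>T\<^esub> (i' \<cdot>\<^bsub>T\<^esub> p') = ident T P"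

locale preadditive_category = category T
  for T :: "('o, 'm, 'z) preadditive_category_scheme" (structure) +
  assumes comm_group_Hom: "\<lbrakk>A \<in> Obj T; B \<in> Obj T\<rbrakk> \<Longrightarrow> comm_group (hom_group T A B)"
    and cmp_add_left: "\<lbrakk>f \<in> Hom T A B; g \<in> Hom T B C; g' \<in> Hom T B C\<rbrakk>
          \<Longrightarrow> (g \<boxplus> g') \<cdot> f = (g \<cdot> f) \<boxplus> (g' \<cdot> f)"
    and cmp_add_right: "\<lbrakk>f \<in> Hom T A B; f' \<in> Hom T A B; g \<in> Hom T B C\<rbrakk>
          \<Longrightarrow> g \<cdot> (f \<boxplus> f') = (g \<cdot> f) \<boxplus> (g \<cdot> f')"

locale additive_category = preadditive_category T
  for T :: "('o, 'm, 'z) preadditive_category_scheme" (structure) +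
  assumes ex_zero_object: "\<exists>Z. zero_object T Z"
    and ex_biproduct: "\<lbrakk>B \<in> Obj T; B' \<in> Obj T\<rbrakk>
          \<Longrightarrow> \<exists>P \<in> Obj T. \<exists>i i' p p'. is_biproduct T B B' P i i' p p'"


section \<open>Triangulated categories\<close>

text \<open>
  A triple \<open>(u, v, w)\<close> in \<^const>\<open>triangles\<close> is a distinguished triangle
  \<open>X \<rightarrow> Y \<rightarrow> Z \<rightarrow> \<Sigma> X\<close>. The shift is only required to be an additive autoequivalence, not an
  automorphism.
\<close>

locale triangulated_category = additive_category T
  for T :: "('o, 'm, 'z) triangulated_category_scheme" (structure) +
  assumes shift_obj: "A \<in> Obj T \<Longrightarrow> shift_obj T A \<in> Obj T"
    and shift_ident: "A \<in> Obj T \<Longrightarrow> shift_arr T (ident T A) = ident T (shift_obj T A)"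
    and shift_cmp: "\<lbrakk>f \<in> Hom T A B; g \<in> Hom T B C\<rbrakk>
          \<Longrightarrow> shift_arr T (g \<cdot> f) = shift_arr T g \<cdot> shift_arr T f"
    and shift_add: "\<lbrakk>f \<in> Hom T A B; g \<in> Hom T A B\<rbrakk>
          \<Longrightarrow> shift_arr T (f \<boxplus> g) = shift_arr T f \<boxplus> shift_arr T g"
    and shift_fully_faithful: "\<lbrakk>A \<in> Obj T; B \<in> Obj T\<rbrakk>
          \<Longrightarrow> bij_betw (shift_arr T) (Hom T A B) (Hom T (shift_obj T A) (shift_obj T B))"
    and shift_ess_surj: "B \<in> Obj T \<Longrightarrow> \<exists>A \<in> Obj T. iso_obj T (shift_obj T A) B"
    and triangle_ends: "(u, v, w) \<in> triangles T
          \<Longrightarrow> \<exists>X Y Z. u \<in> Hom T X Y \<and> v \<in> Hom T Y Z \<and> w \<in> Hom T Z (shift_obj T X)"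
    and TR1_iso: "\<lbrakk>(u, v, w) \<in> triangles T;
            u \<in> Hom T X Y; v \<in> Hom T Y Z; w \<in> Hom T Z (shift_obj T X);
            u' \<in> Hom T X' Y'; v' \<in> Hom T Y' Z'; w' \<in> Hom T Z' (shift_obj T X');
            a \<in> Hom T X X'; b \<in> Hom T Y Y'; c \<in> Hom T Z Z';
            iso_arr T a; iso_arr T b; iso_arr T c;
            b \<cdot> u = u' \<cdot> a; c \<cdot> v = v' \<cdot> b; shift_arr T a \<cdot> w = w' \<cdot> c\<rbrakk>
          \<Longrightarrow> (u', v', w') \<in> triangles T"
    and TR1_ident: "\<lbrakk>X \<in> Obj T; zero_object T Z\<rbrakk>
          \<Longrightarrow> (ident T X, zero_arr T X Z, zero_arr T Z (shift_obj T X)) \<in> triangles T"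
    and TR1_cone: "u \<in> Arr T \<Longrightarrow> \<exists>v w. (u, v, w) \<in> triangles T"
    and TR2: "\<lbrakk>u \<in> Hom T X Y; v \<in> Hom T Y Z; w \<in> Hom T Z (shift_obj T X)\<rbrakk>
          \<Longrightarrow> (u, v, w) \<in> triangles T \<longleftrightarrow> (v, w, neg_arr T (shift_arr T u)) \<in> triangles T"
    and TR3: "\<lbrakk>(u, v, w) \<in> triangles T; (u', v', w') \<in> triangles T;
            a \<in> Hom T (Dom T u) (Dom T u'); b \<in> Hom T (Cod T u) (Cod T u');
            b \<cdot> u = u' \<cdot> a\<rbrakk>
          \<Longrightarrow> \<exists>c \<in> Hom T (Cod T v) (Cod T v'). c \<cdot> v = v' \<cdot> b \<and> w' \<cdot> c = shift_arr T a \<cdot> w"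
    \<comment> \<open>octahedral axiom: \<open>u : X \<rightarrow> Y\<close> has cone \<open>Z'\<close>, \<open>v : Y \<rightarrow> Z\<close> has cone \<open>X'\<close>,
       \<open>v \<cdot> u\<close> has cone \<open>Y'\<close>, and the three cones form a triangle \<open>Z' \<rightarrow> Y' \<rightarrow> X' \<rightarrow> \<Sigma> Z'\<close>\<close>
    and TR4: "\<lbrakk>u \<in> Hom T X Y; v \<in> Hom T Y Z;
            (u, j, k) \<in> triangles T; (v, l, i) \<in> triangles T; (v \<cdot> u, m, n) \<in> triangles T\<rbrakk>
          \<Longrightarrow> \<exists>a \<in> Hom T (Cod T j) (Cod T m). \<exists>b \<in> Hom T (Cod T m) (Cod T l).
                (a, b, shift_arr T j \<cdot> i) \<in> triangles T \<and>
                a \<cdot> j = m \<cdot> v \<and> n \<cdot> a = k \<and> b \<cdot> m = l \<and> i \<cdot> b = shift_arr T u \<cdot> n"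


section \<open>Coproducts, compact objects, compact generation\<close>

text \<open>
  In HOL the distinction between sets and proper classes has to be relative to a universe. Here
  the universe is an arbitrary type \<open>'u\<close>: a collection is small (a \<^emph>\<open>set\<close>) if its cardinality is
  less than that of \<open>'u\<close>, so that when \<open>'u\<close> has the cardinality of a Grothendieck universe (or is
  a type of all ZFC sets) this is smallness in the usual sense. No closure property of the
  universe is imposed. Small coproducts are taken over index sets contained in \<open>'u\<close>; every small
  index set is in bijection with one of these.
\<close>

definition small :: "'u itself \<Rightarrow> 'a set \<Rightarrow> bool" where
  "small U S \<longleftrightarrow> S \<prec> (UNIV :: 'u set)"

definition has_coproducts :: "'u itself \<Rightarrow> ('o, 'm, 'z) category_scheme \<Rightarrow> bool" where
  "has_coproducts U T \<longleftrightarrow>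
     (\<forall>(I :: 'u set) X. small U I \<and> X \<in> I \<rightarrow> Obj T \<longrightarrow> (\<exists>P \<iota>. is_coproduct T I X P \<iota>))"

text \<open>
  \<open>Hom(A, -)\<close> commutes with coproducts: the canonical map from the direct sum of the groups
  \<open>Hom(A, X i)\<close> to \<open>Hom(A, P)\<close> is an isomorphism for every small coproduct \<open>P\<close> of the \<open>X i\<close>.
  The function \<^const>\<open>gfinprod\<close> multiplies the finitely many nontrivial factors; as the groups are
  written additively here, this is a sum.
\<close>

definition compact_object ::
  "'u itself \<Rightarrow> ('o, 'm, 'z) preadditive_category_scheme \<Rightarrow> 'o \<Rightarrow> bool" where
  "compact_object U T A \<longleftrightarrow> A \<in> Obj T \<and>
     (\<forall>(I :: 'u set) X P \<iota>. small U I \<and> is_coproduct T I X P \<iota> \<longrightarrow>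
        (\<lambda>h. gfinprod (hom_group T A P) (\<lambda>i. \<iota> i \<cdot>\<^bsub>T\<^esub> h i) I)
          \<in> iso (sum_group I (\<lambda>i. hom_group T A (X i))) (hom_group T A P))"

locale compactly_generated_triangulated_category = triangulated_category T
  for U :: "'u itself" and T :: "('o, 'm, 'z) triangulated_category_scheme" (structure) +
  assumes small_Hom: "\<lbrakk>A \<in> Obj T; B \<in> Obj T\<rbrakk> \<Longrightarrow> small U (Hom T A B)"
    and coproducts: "has_coproducts U T"
    and small_compacts: "\<exists>S. small U S \<and> (\<forall>A\<in>S. compact_object U T A) \<and>
          (\<forall>A. compact_object U T A \<longrightarrow> (\<exists>B\<in>S. iso_obj T A B))"
    and compacts_generate: "\<lbrakk>X \<in> Obj T;
            \<And>A. compact_object U T A \<Longrightarrow> Hom T A X = {zero_arr T A X}\<rbrakk> \<Longrightarrow> zero_object T X"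


section \<open>Positive primitive formulas\<close>

text \<open>
  The sorts are the compact objects. A variable is an index together with its sort.
  \<open>App f t\<close> is the function symbol of \<open>f : A \<rightarrow> B\<close> applied to a term \<open>t\<close> of sort \<open>B\<close>; it has
  sort \<open>A\<close> and is written \<open>t f\<close> on paper. \<open>PP ys eqs\<close> is the formula \<open>\<exists>ys. \<And>eqs\<close>, where a pair of
  terms in \<open>eqs\<close> stands for the equation between them.
\<close>

datatype ('o, 'm) pp_term =
    Var "nat \<times> 'o"
  | Zero 'o
  | Add "('o, 'm) pp_term" "('o, 'm) pp_term"
  | App 'm "('o, 'm) pp_term"

datatype ('o, 'm) pp_formula =
  PP (bound_vars: "(nat \<times> 'o) list") (equations: "(('o, 'm) pp_term \<times> ('o, 'm) pp_term) list")

primrec term_vars :: "('o, 'm) pp_term \<Rightarrow> (nat \<times> 'o) set" where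
  "term_vars (Var x) = {x}"
| "term_vars (Zero A) = {}"
| "term_vars (Add s t) = term_vars s \<union> term_vars t"
| "term_vars (App f t) = term_vars t"

primrec term_sort :: "('o, 'm, 'z) category_scheme \<Rightarrow> ('o, 'm) pp_term \<Rightarrow> 'o" where
  "term_sort T (Var x) = snd x"
| "term_sort T (Zero A) = A"
| "term_sort T (Add s t) = term_sort T s"
| "term_sort T (App f t) = Dom T f"

primrec well_sorted ::
  "'u itself \<Rightarrow> ('o, 'm, 'z) preadditive_category_scheme \<Rightarrow> ('o, 'm) pp_term \<Rightarrow> bool" where
  "well_sorted U T (Var x) \<longleftrightarrow> compact_object U T (snd x)"
| "well_sorted U T (Zero A) \<longleftrightarrow> compact_object U T A"
| "well_sorted U T (Add s t) \<longleftrightarrow>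
     well_sorted U T s \<and> well_sorted U T t \<and> term_sort T s = term_sort T t"
| "well_sorted U T (App f t) \<longleftrightarrow>
     f \<in> Arr T \<and> compact_object U T (Dom T f) \<and> compact_object U T (Cod T f) \<and>
     well_sorted U T t \<and> term_sort T t = Cod T f"

definition pp_formula_of ::
  "'u itself \<Rightarrow> ('o, 'm, 'z) preadditive_category_scheme \<Rightarrow> ('o, 'm) pp_formula \<Rightarrow> bool" where
  "pp_formula_of U T \<phi> \<longleftrightarrow>
     (\<forall>y \<in> set (bound_vars \<phi>). compact_object U T (snd y)) \<and>
     (\<forall>(s, t) \<in> set (equations \<phi>).
        well_sorted U T s \<and> well_sorted U T t \<and> term_sort T s = term_sort T t)"

definition free_vars :: "('o, 'm) pp_formula \<Rightarrow> (nat \<times> 'o) set" where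
  "free_vars \<phi> = (\<Union>(s, t) \<in> set (equations \<phi>). term_vars s \<union> term_vars t) - set (bound_vars \<phi>)"

primrec eval_term ::
  "('o, 'm, 'z) preadditive_category_scheme \<Rightarrow> 'o \<Rightarrow> (nat \<times> 'o \<Rightarrow> 'm) \<Rightarrow> ('o, 'm) pp_term \<Rightarrow> 'm"
  where
  "eval_term T X v (Var x) = v x"
| "eval_term T X v (Zero A) = zero_arr T A X"
| "eval_term T X v (Add s t) = eval_term T X v s \<boxplus>\<^bsub>T\<^esub> eval_term T X v t"
| "eval_term T X v (App f t) = eval_term T X v t \<cdot>\<^bsub>T\<^esub> f"

text \<open>The solution set consists of assignments of elements of \<open>X\<close> to the free variables.\<close>

definition solution_set ::
  "('o, 'm, 'z) preadditive_category_scheme \<Rightarrow> 'o \<Rightarrow> ('o, 'm) pp_formula \<Rightarrow> (nat \<times> 'o \<Rightarrow> 'm) set"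
  where
  "solution_set T X \<phi> =
     {v \<in> \<Pi>\<^sub>E x \<in> free_vars \<phi>. Hom T (snd x) X.
        \<exists>w \<in> \<Pi> y \<in> set (bound_vars \<phi>) \<union> free_vars \<phi>. Hom T (snd y) X.
          (\<forall>x \<in> free_vars \<phi>. w x = v x) \<and>
          (\<forall>(s, t) \<in> set (equations \<phi>). eval_term T X w s = eval_term T X w t)}"

definition pp_equivalent ::
  "'u itself \<Rightarrow> ('o, 'm, 'z) preadditive_category_scheme \<Rightarrow>
     ('o, 'm) pp_formula \<Rightarrow> ('o, 'm) pp_formula \<Rightarrow> bool" where
  "pp_equivalent U T \<phi> \<psi> \<longleftrightarrow>
     pp_formula_of U T \<phi> \<and> pp_formula_of U T \<psi> \<and> free_vars \<phi> = free_vars \<psi> \<and>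
     (\<forall>X \<in> Obj T. solution_set T X \<phi> = solution_set T X \<psi>)"

text \<open>
  In the following formulas the free variable has index \<open>0\<close> and the bound variable index \<open>1\<close>, so
  that they are different even if their sorts agree.
\<close>

text \<open>\<open>\<exists>x\<^sub>B\<^sub>'. x\<^sub>B f = x\<^sub>B\<^sub>' f'\<close> for \<open>f : A \<rightarrow> B\<close> and \<open>f' : A \<rightarrow> B'\<close>\<close>
definition typical_pp ::
  "('o, 'm, 'z) category_scheme \<Rightarrow> 'm \<Rightarrow> 'm \<Rightarrow> ('o, 'm) pp_formula" where
  "typical_pp T f f' =
     PP [(1, Cod T f')] [(App f (Var (0, Cod T f)), App f' (Var (1, Cod T f')))]"

text \<open>\<open>g | x\<^sub>B\<close>, that is \<open>\<exists>y\<^sub>C. x\<^sub>B = y\<^sub>C g\<close>, for \<open>g : B \<rightarrow> C\<close>\<close>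
definition divisibility ::
  "('o, 'm, 'z) category_scheme \<Rightarrow> 'm \<Rightarrow> ('o, 'm) pp_formula" where
  "divisibility T g = PP [(1, Cod T g)] [(Var (0, Dom T g), App g (Var (1, Cod T g)))]"

text \<open>\<open>x\<^sub>B f'' = 0\<close> for \<open>f'' : A' \<rightarrow> B\<close>\<close>
definition annihilation ::
  "('o, 'm, 'z) category_scheme \<Rightarrow> 'm \<Rightarrow> ('o, 'm) pp_formula" where
  "annihilation T f'' = PP [] [(App f'' (Var (0, Cod T f'')), Zero (Dom T f''))]"

end

theory Submission
  imports Defs
begin

text \<open>
  A triangle makes its second map a weak cokernel of the first. Hence \<open>x f = y f'\<close> is solvable iff
  some \<open>(x, -y)\<close> kills \<open>A \<rightarrow> B \<oplus> B'\<close>, iff \<open>(x, -y)\<close> factors through \<open>(g, g')\<close>, iff \<open>g | x\<close>; and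
  \<open>g | x\<close> iff \<open>x f'' = 0\<close>. The new formulas are formulas of the language only because \<open>C\<close> and \<open>A'\<close>
  are compact: compact objects are closed under biproducts, shifts, desuspensions and cones.
\<close>

section \<open>Preadditive categories\<close>

text \<open>Two obstacles shape the closure properties. Compactness is defined by bijectivity of a
  comparison map built with \<open>gfinprod\<close>; it is traded for equations
  \<open>e \<cdot> a = a\<close> with \<open>e\<close> a finite truncation, so that closure under
  cones becomes a computation with bilinear composition instead of a five lemma argument over long
  exact sequences. And the shift comes without an inverse functor: it is only fully faithful and
  essentially surjective. Desuspending a coproduct therefore takes a chosen isomorphism for each
  summand and one for the coproduct object, and truncations are conjugated by the latter. The index
  set stays the same in all these transports, so smallness carries over. Signs are kept out:
  differences enter as solutions \<open>d\<close> of \<open>d \<boxplus> g = f\<close>, and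
  \<open>neg_arr\<close> occurs only in the third map of a rotated triangle.\<close>

text \<open>Finite support is essential: \<open>gfinprod\<close> takes the default value one on
  infinite support, and a homomorphism may kill all but finitely many factors. With it, both sides
  are ordinary products over the support \<open>J\<close> of \<open>f\<close>, since factors outside
  \<open>J\<close> are sent to one.\<close>

lemma gfinprod_hom:
  assumes "comm_group G" "comm_group H" "\<phi> \<in> hom G H" "f \<in> I \<rightarrow> carrier G"
    and fin: "finite {i \<in> I. f i \<noteq> \<one>\<^bsub>G\<^esub>}"
  shows "\<phi> (gfinprod G f I) = gfinprod H (\<lambda>i. \<phi> (f i)) I"
proof -
  interpret G: comm_group G by fact
  interpret H: comm_group H by fact
  interpret group_hom G H \<phi>
    by unfold_locales (rule assms(3))
  define J where "J = {i \<in> I. f i \<noteq> \<one>\<^bsub>G\<^esub>}"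
  have *: "\<phi> (finprod G f F) = finprod H (\<lambda>i. \<phi> (f i)) F" if "finite F" "F \<subseteq> J" for F
    using that
  proof (induction F rule: finite_induct)
    case empty
    then show ?case by simp
  next
    case (insert i F)
    have "f \<in> F \<rightarrow> carrier G" "f i \<in> carrier G"
      using insert.prems assms(4) by (auto simp: J_def)
    moreover have "(\<lambda>i. \<phi> (f i)) \<in> F \<rightarrow> carrier H" "\<phi> (f i) \<in> carrier H"
      using calculation by (auto simp: Pi_iff)
    ultimately show ?case
      using insert by simp
  qed
  have "gfinprod H (\<lambda>i. \<phi> (f i)) I = gfinprod H (\<lambda>i. \<phi> (f i)) J"
    using assms(4) by (intro H.gfinprod_mono_neutral_cong_right) (auto simp: J_def Pi_iff)
  also have "\<dots> = finprod H (\<lambda>i. \<phi> (f i)) J"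
    using assms(4) fin by (intro H.gfinprod_eq_finprod) (auto simp: J_def Pi_iff)
  also have "\<dots> = \<phi> (finprod G f J)"
    using * fin by (simp add: J_def)
  also have "finprod G f J = gfinprod G f I"
    using fin by (simp add: gfinprod_def J_def)
  finally show ?thesis by simp
qed

lemma (in comm_group) gfinprod_single:
  assumes "i \<in> I" "f i \<in> carrier G" "\<And>j. j \<in> I \<Longrightarrow> j \<noteq> i \<Longrightarrow> f j = \<one>"
  shows "gfinprod G f I = f i"
proof -
  have "gfinprod G f I = gfinprod G f {i}"
    using assms by (intro gfinprod_mono_neutral_cong_right) (auto, metis one_closed)
  also have "\<dots> = f i"
    using assms by simp
  finally show ?thesis .
qed

context category
begin

lemma Hom_Obj: "f \<in> Hom T A B \<Longrightarrow> A \<in> Obj T \<and> B \<in> Obj T"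
  using arr_ends by (auto simp: Hom_def)

end

context preadditive_category
begin

lemma zero_Hom: "A \<in> Obj T \<Longrightarrow> B \<in> Obj T \<Longrightarrow> zero_arr T A B \<in> Hom T A B"
  using comm_group_Hom[THEN comm_group.axioms(1), THEN comm_monoid.axioms(1), THEN monoid.one_closed]
  by (simp add: hom_group_def)

lemma add_Hom: "f \<in> Hom T A B \<Longrightarrow> g \<in> Hom T A B \<Longrightarrow> f \<boxplus> g \<in> Hom T A B"
  using comm_group_Hom[THEN comm_group.axioms(1), THEN comm_monoid.axioms(1), THEN monoid.m_closed] Hom_Obj
  by (simp add: hom_group_def)

lemma zero_add: "f \<in> Hom T A B \<Longrightarrow> zero_arr T A B \<boxplus> f = f"
  using comm_group_Hom[THEN comm_group.axioms(1), THEN comm_monoid.axioms(1), THEN monoid.l_one] Hom_Obj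
  by (simp add: hom_group_def)

lemma add_zero: "f \<in> Hom T A B \<Longrightarrow> f \<boxplus> zero_arr T A B = f"
  using comm_group_Hom[THEN comm_group.axioms(1), THEN comm_monoid.axioms(1), THEN monoid.r_one] Hom_Obj
  by (simp add: hom_group_def)

lemma add_right_cancel:
  assumes "f \<in> Hom T A B" "g \<in> Hom T A B" "h \<in> Hom T A B" "f \<boxplus> h = g \<boxplus> h"
  shows "f = g"
proof -
  interpret comm_group "hom_group T A B"
    using assms Hom_Obj comm_group_Hom by blast
  show ?thesis
    using right_cancel[of h f g] assms by (simp add: hom_group_def)
qed

text \<open>Subtraction in a form that bilinearity of composition respects directly, so that no
  rules for composing with inverses have to be proved.\<close>

lemma ex_diff:
  assumes "f \<in> Hom T A B" "g \<in> Hom T A B"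
  obtains d where "d \<in> Hom T A B" "d \<boxplus> g = f"
proof -
  interpret comm_group "hom_group T A B"
    using assms Hom_Obj comm_group_Hom by blast
  have "\<exists>d\<in>carrier (hom_group T A B). d \<otimes>\<^bsub>hom_group T A B\<^esub> g = f"
    using assms add_zero[OF assms(1)] add_Hom[OF assms(1)]
    by (intro bexI[of _ "f \<otimes>\<^bsub>hom_group T A B\<^esub> inv\<^bsub>hom_group T A B\<^esub> g"])
       (use inv_closed[of g] l_inv[of g] m_assoc[of f "inv\<^bsub>hom_group T A B\<^esub> g" g] in
         \<open>simp_all add: hom_group_def\<close>)
  then show thesis
    using that by (auto simp: hom_group_def)
qed

lemma cmp_zero_left:
  assumes "f \<in> Hom T A B" "C \<in> Obj T"
  shows "zero_arr T B C \<cdot> f = zero_arr T A C"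
proof -
  have ob: "A \<in> Obj T" "B \<in> Obj T" and z: "zero_arr T B C \<in> Hom T B C"
    using Hom_Obj assms zero_Hom by blast+
  have "(zero_arr T B C \<cdot> f) \<boxplus> (zero_arr T B C \<cdot> f) = zero_arr T A C \<boxplus> (zero_arr T B C \<cdot> f)"
    using cmp_add_left[OF assms(1) z z] zero_add z cmp_Hom[OF assms(1) z] by simp
  then show ?thesis
    using add_right_cancel cmp_Hom[OF assms(1) z] zero_Hom ob assms(2) by blast
qed

lemma cmp_zero_right:
  assumes "f \<in> Hom T B C" "A \<in> Obj T"
  shows "f \<cdot> zero_arr T A B = zero_arr T A C"
proof -
  have ob: "B \<in> Obj T" "C \<in> Obj T" and z: "zero_arr T A B \<in> Hom T A B"
    using Hom_Obj assms zero_Hom by blast+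
  have "(f \<cdot> zero_arr T A B) \<boxplus> (f \<cdot> zero_arr T A B) = zero_arr T A C \<boxplus> (f \<cdot> zero_arr T A B)"
    using cmp_add_right[OF z z assms(1)] zero_add z cmp_Hom[OF z assms(1)] by simp
  then show ?thesis
    using add_right_cancel cmp_Hom[OF z assms(1)] zero_Hom ob assms(2) by blast
qed

lemma hom_group_postcomp:
  "k \<in> Hom T B C \<Longrightarrow> A \<in> Obj T \<Longrightarrow> (\<lambda>f. k \<cdot> f) \<in> hom (hom_group T A B) (hom_group T A C)"
  by (auto simp: hom_def hom_group_def cmp_add_right intro: cmp_Hom)

lemma hom_group_precomp:
  "k \<in> Hom T A B \<Longrightarrow> C \<in> Obj T \<Longrightarrow> (\<lambda>f. f \<cdot> k) \<in> hom (hom_group T B C) (hom_group T A C)"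
  by (auto simp: hom_def hom_group_def cmp_add_left intro: cmp_Hom)

section \<open>Finite truncations of coproducts and compactness\<close>

text \<open>
  The endomorphism of the coproduct that projects onto the summands in \<open>F\<close>. An object \<open>A\<close> is
  compact iff every morphism from \<open>A\<close> to a coproduct is fixed by such an endomorphism with \<open>F\<close>
  finite; injectivity of the comparison map is automatic because a coproduct in an additive
  category has projections onto its summands.
\<close>

definition truncation ::
  "'i set \<Rightarrow> ('i \<Rightarrow> 'o) \<Rightarrow> 'o \<Rightarrow> ('i \<Rightarrow> 'm) \<Rightarrow> 'i set \<Rightarrow> 'm \<Rightarrow> bool" where
  "truncation I X P \<iota> F e \<longleftrightarrow> e \<in> Hom T P P \<and>
     (\<forall>i\<in>I. e \<cdot> \<iota> i = (if i \<in> F then \<iota> i else zero_arr T (X i) P))"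

text \<open>Expresses that \<open>a\<close> factors through the coproduct over a finite
  \<open>F\<close> without constructing that object: the endomorphism \<open>e\<close>, which is
  idempotent, stands in for it.\<close>

definition factors_finitely ::
  "'i set \<Rightarrow> ('i \<Rightarrow> 'o) \<Rightarrow> 'o \<Rightarrow> ('i \<Rightarrow> 'm) \<Rightarrow> 'm \<Rightarrow> bool" where
  "factors_finitely I X P \<iota> a \<longleftrightarrow>
     (\<exists>F e. finite F \<and> F \<subseteq> I \<and> truncation I X P \<iota> F e \<and> e \<cdot> a = a)"

lemma coproduct_Hom:
  assumes "is_coproduct T I X P \<iota>" "i \<in> I"
  shows "\<iota> i \<in> Hom T (X i) P" "X i \<in> Obj T" "P \<in> Obj T"
  using assms by (auto simp: is_coproduct_def)

lemma coproduct_ex: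
  assumes "is_coproduct T I X P \<iota>" "Y \<in> Obj T" "\<And>i. i \<in> I \<Longrightarrow> h i \<in> Hom T (X i) Y"
  shows "\<exists>k \<in> Hom T P Y. \<forall>i\<in>I. k \<cdot> \<iota> i = h i"
proof -
  have "\<forall>h. (\<forall>i\<in>I. h i \<in> Hom T (X i) Y) \<longrightarrow> (\<exists>!k. k \<in> Hom T P Y \<and> (\<forall>i\<in>I. k \<cdot> \<iota> i = h i))"
    using assms(1,2) by (simp add: is_coproduct_def)
  then show ?thesis
    using assms(3) by blast
qed

lemma coproduct_eqI:
  assumes P: "is_coproduct T I X P \<iota>" and k: "k \<in> Hom T P Y" "k' \<in> Hom T P Y"
    and eq: "\<And>i. i \<in> I \<Longrightarrow> k \<cdot> \<iota> i = k' \<cdot> \<iota> i"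
  shows "k = k'"
proof -
  have "\<forall>i\<in>I. k \<cdot> \<iota> i \<in> Hom T (X i) Y"
    using coproduct_Hom(1)[OF P] k cmp_Hom by blast
  moreover have "\<forall>h. (\<forall>i\<in>I. h i \<in> Hom T (X i) Y) \<longrightarrow>
      (\<exists>!k. k \<in> Hom T P Y \<and> (\<forall>i\<in>I. k \<cdot> \<iota> i = h i))"
    using P Hom_Obj[OF k(1)] by (simp add: is_coproduct_def)
  ultimately have "\<exists>!l. l \<in> Hom T P Y \<and> (\<forall>i\<in>I. l \<cdot> \<iota> i = k \<cdot> \<iota> i)"
    by (auto dest: spec[of _ "\<lambda>i. k \<cdot> \<iota> i"])
  moreover have "\<forall>i\<in>I. k' \<cdot> \<iota> i = k \<cdot> \<iota> i"
    using eq by simp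
  ultimately show ?thesis
    using k by blast
qed

lemma truncation_ex:
  assumes "is_coproduct T I X P \<iota>"
  shows "\<exists>e. truncation I X P \<iota> F e"
proof -
  have P: "P \<in> Obj T"
    using assms by (simp add: is_coproduct_def)
  have "(if i \<in> F then \<iota> i else zero_arr T (X i) P) \<in> Hom T (X i) P" if "i \<in> I" for i
    using coproduct_Hom[OF assms that] zero_Hom by auto
  from coproduct_ex[OF assms P, of "\<lambda>i. if i \<in> F then \<iota> i else zero_arr T (X i) P", OF this]
  show ?thesis
    unfolding truncation_def by blast
qed

text \<open>Tested on injections: for \<open>i\<close> in \<open>F\<close> both truncations fix
  \<open>\<iota> i\<close>, and otherwise \<open>e\<close> already sends it to zero.\<close>

lemma truncation_cmp:
  assumes P: "is_coproduct T I X P \<iota>" and "F \<subseteq> G"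
    and F: "truncation I X P \<iota> F e" and G: "truncation I X P \<iota> G e'"
  shows "e' \<cdot> e = e"
proof (rule coproduct_eqI[OF P])
  have e: "e \<in> Hom T P P" "e' \<in> Hom T P P"
    using F G by (auto simp: truncation_def)
  then show "e' \<cdot> e \<in> Hom T P P" "e \<in> Hom T P P"
    using cmp_Hom by blast+
  fix i assume i: "i \<in> I"
  note h = coproduct_Hom[OF P i]
  show "(e' \<cdot> e) \<cdot> \<iota> i = e \<cdot> \<iota> i"
    using F G i h e \<open>F \<subseteq> G\<close> cmp_zero_right[OF e(2) h(2)]
    by (auto simp: cmp_assoc[OF h(1) e] truncation_def)
qed

text \<open>This lets several finite supports be merged into their union. With \<open>F = G\<close>
  it exchanges one truncation at \<open>F\<close> for another.\<close>

lemma truncation_fixes_mono: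
  assumes P: "is_coproduct T I X P \<iota>" and "F \<subseteq> G"
    and F: "truncation I X P \<iota> F e" and G: "truncation I X P \<iota> G e'"
    and a: "a \<in> Hom T A P" "e \<cdot> a = a"
  shows "e' \<cdot> a = a"
proof -
  have e: "e \<in> Hom T P P" "e' \<in> Hom T P P"
    using F G by (auto simp: truncation_def)
  show ?thesis
    using cmp_assoc[OF a(1) e] truncation_cmp[OF assms(1-4)] a by simp
qed

lemma projection_ex:
  assumes "is_coproduct T I X P \<iota>" "j \<in> I"
  obtains \<pi> where "\<pi> \<in> Hom T P (X j)" "\<pi> \<cdot> \<iota> j = ident T (X j)"
    "\<And>i. i \<in> I \<Longrightarrow> i \<noteq> j \<Longrightarrow> \<pi> \<cdot> \<iota> i = zero_arr T (X i) (X j)"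
proof -
  have "(if i = j then ident T (X j) else zero_arr T (X i) (X j)) \<in> Hom T (X i) (X j)" if "i \<in> I" for i
    using coproduct_Hom[OF assms(1)] assms(2) that zero_Hom ident_Hom by auto
  from coproduct_ex[OF assms(1) coproduct_Hom(2)[OF assms],
      of "\<lambda>i. if i = j then ident T (X j) else zero_arr T (X i) (X j)", OF this]
  obtain k where "k \<in> Hom T P (X j)"
      "\<forall>i\<in>I. k \<cdot> \<iota> i = (if i = j then ident T (X j) else zero_arr T (X i) (X j))"
    by blast
  then show thesis
    using that[of k] assms(2) by simp
qed

section \<open>The comparison map from the direct sum to maps into the coproduct\<close>

lemma sum_group_carrier:
  assumes "is_coproduct T I X P \<iota>" "A \<in> Obj T"
  shows "carrier (sum_group I (\<lambda>i. hom_group T A (X i))) =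
    {h \<in> \<Pi>\<^sub>E i\<in>I. Hom T A (X i). finite {i \<in> I. h i \<noteq> zero_arr T A (X i)}}"
proof -
  have "group (hom_group T A (X i))" if "i \<in> I" for i
    using comm_group_Hom assms(2) coproduct_Hom(2)[OF assms(1) that] comm_group.axioms(2) by blast
  from carrier_sum_group[OF this] show ?thesis
    by (simp add: hom_group_def)
qed

text \<open>Injecting a zero component gives zero, so finite support is inherited; these are the
  side conditions that make the \<open>gfinprod\<close> of the comparison map a genuine finite
  sum.\<close>

lemma comparison_terms:
  assumes P: "is_coproduct T I X P \<iota>" and A: "A \<in> Obj T"
    and h: "h \<in> carrier (sum_group I (\<lambda>i. hom_group T A (X i)))"
  shows "(\<lambda>i. \<iota> i \<cdot> h i) \<in> I \<rightarrow> Hom T A P" "finite {i \<in> I. \<iota> i \<cdot> h i \<noteq> zero_arr T A P}"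
proof -
  show "(\<lambda>i. \<iota> i \<cdot> h i) \<in> I \<rightarrow> Hom T A P"
    using h coproduct_Hom[OF P] by (auto simp: sum_group_carrier[OF P A] intro!: cmp_Hom)
  have "{i \<in> I. \<iota> i \<cdot> h i \<noteq> zero_arr T A P} \<subseteq> {i \<in> I. h i \<noteq> zero_arr T A (X i)}"
    using cmp_zero_right[OF coproduct_Hom(1)[OF P] A] by auto
  then show "finite {i \<in> I. \<iota> i \<cdot> h i \<noteq> zero_arr T A P}"
    by (rule finite_subset) (use h in \<open>simp add: sum_group_carrier[OF P A]\<close>)
qed

lemma cmp_gfinprod_left:
  assumes k: "k \<in> Hom T B C" and A: "A \<in> Obj T"
    and f: "f \<in> I \<rightarrow> Hom T A B" and fin: "finite {i \<in> I. f i \<noteq> zero_arr T A B}"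
  shows "k \<cdot> gfinprod (hom_group T A B) f I = gfinprod (hom_group T A C) (\<lambda>i. k \<cdot> f i) I"
proof -
  have "B \<in> Obj T" "C \<in> Obj T"
    using Hom_Obj k by auto
  then show ?thesis
    using gfinprod_hom[OF comm_group_Hom comm_group_Hom hom_group_postcomp[OF k A]] A f fin
    by (simp add: hom_group_def)
qed

lemma cmp_gfinprod_right:
  assumes k: "k \<in> Hom T A B" and C: "C \<in> Obj T"
    and f: "f \<in> I \<rightarrow> Hom T B C" and fin: "finite {i \<in> I. f i \<noteq> zero_arr T B C}"
  shows "gfinprod (hom_group T B C) f I \<cdot> k = gfinprod (hom_group T A C) (\<lambda>i. f i \<cdot> k) I"
proof -
  have "A \<in> Obj T" "B \<in> Obj T"
    using Hom_Obj k by auto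
  then show ?thesis
    using gfinprod_hom[OF comm_group_Hom comm_group_Hom hom_group_precomp[OF k C]] C f fin
    by (simp add: hom_group_def)
qed

lemma gfinprod_Hom:
  assumes "A \<in> Obj T" "B \<in> Obj T" "f \<in> I \<rightarrow> Hom T A B"
  shows "gfinprod (hom_group T A B) f I \<in> Hom T A B"
proof -
  interpret comm_group "hom_group T A B"
    using assms comm_group_Hom by blast
  show ?thesis
    using gfinprod_closed[of f I] assms by (simp add: hom_group_def)
qed

lemma gfinprod_Hom_single:
  assumes "i \<in> I" "f i \<in> Hom T A B" "\<And>j. j \<in> I \<Longrightarrow> j \<noteq> i \<Longrightarrow> f j = zero_arr T A B"
  shows "gfinprod (hom_group T A B) f I = f i"
proof -
  interpret comm_group "hom_group T A B"
    using assms comm_group_Hom Hom_Obj by blast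
  show ?thesis
    using assms by (intro gfinprod_single) (auto simp: hom_group_def)
qed

lemma gfinprod_Hom_cong:
  assumes "A \<in> Obj T" "B \<in> Obj T" "f \<in> I \<rightarrow> Hom T A B" "\<And>i. i \<in> I \<Longrightarrow> f i = g i"
  shows "gfinprod (hom_group T A B) f I = gfinprod (hom_group T A B) g I"
proof -
  interpret comm_group "hom_group T A B"
    using assms comm_group_Hom by blast
  show ?thesis
    using assms by (intro gfinprod_cong) (auto simp: hom_group_def)
qed

lemma comparison_hom:
  assumes P: "is_coproduct T I X P \<iota>" and A: "A \<in> Obj T"
  shows "(\<lambda>h. gfinprod (hom_group T A P) (\<lambda>i. \<iota> i \<cdot> h i) I)
    \<in> hom (sum_group I (\<lambda>i. hom_group T A (X i))) (hom_group T A P)"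
    (is "_ \<in> hom ?S ?H")
proof (rule homI)
  have PO: "P \<in> Obj T"
    using P by (simp add: is_coproduct_def)
  interpret comm_group ?H
    using A PO comm_group_Hom by blast
  fix h assume h: "h \<in> carrier ?S"
  show "gfinprod ?H (\<lambda>i. \<iota> i \<cdot> h i) I \<in> carrier ?H"
    using gfinprod_Hom[OF A PO comparison_terms(1)[OF P A h]] by (simp add: hom_group_def)
  fix h' assume h': "h' \<in> carrier ?S"
  have hh: "h i \<in> Hom T A (X i)" "h' i \<in> Hom T A (X i)" if "i \<in> I" for i
    using h h' that by (auto simp: sum_group_carrier[OF P A])
  have "gfinprod ?H (\<lambda>i. \<iota> i \<cdot> (h \<otimes>\<^bsub>?S\<^esub> h') i) I
      = gfinprod ?H (\<lambda>i. (\<iota> i \<cdot> h i) \<otimes>\<^bsub>?H\<^esub> (\<iota> i \<cdot> h' i)) I"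
    using cmp_add_right[OF hh coproduct_Hom(1)[OF P]]
      cmp_Hom[OF hh(1) coproduct_Hom(1)[OF P]] cmp_Hom[OF hh(2) coproduct_Hom(1)[OF P]]
    by (intro gfinprod_Hom_cong A PO) (simp_all add: hom_group_def add_Hom)
  also have "\<dots> = gfinprod ?H (\<lambda>i. \<iota> i \<cdot> h i) I \<otimes>\<^bsub>?H\<^esub> gfinprod ?H (\<lambda>i. \<iota> i \<cdot> h' i) I"
    using comparison_terms[OF P A h] comparison_terms[OF P A h']
    by (intro gfinprod_distrib) (auto simp: hom_group_def)
  finally show "gfinprod ?H (\<lambda>i. \<iota> i \<cdot> (h \<otimes>\<^bsub>?S\<^esub> h') i) I
      = gfinprod ?H (\<lambda>i. \<iota> i \<cdot> h i) I \<otimes>\<^bsub>?H\<^esub> gfinprod ?H (\<lambda>i. \<iota> i \<cdot> h' i) I" .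
qed

lemma comparison_inj:
  assumes P: "is_coproduct T I X P \<iota>" and A: "A \<in> Obj T"
  shows "inj_on (\<lambda>h. gfinprod (hom_group T A P) (\<lambda>i. \<iota> i \<cdot> h i) I)
    (carrier (sum_group I (\<lambda>i. hom_group T A (X i))))"
    (is "inj_on ?\<phi> (carrier ?S)")
proof -
  have component: "\<pi> \<cdot> ?\<phi> h = h j"
    if h: "h \<in> carrier ?S" and j: "j \<in> I"
      and \<pi>: "\<pi> \<in> Hom T P (X j)" "\<pi> \<cdot> \<iota> j = ident T (X j)"
        "\<And>i. i \<in> I \<Longrightarrow> i \<noteq> j \<Longrightarrow> \<pi> \<cdot> \<iota> i = zero_arr T (X i) (X j)"
    for h j \<pi>
  proof -
    have hh: "h i \<in> Hom T A (X i)" if "i \<in> I" for i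
      using h that by (auto simp: sum_group_carrier[OF P A])
    have as: "\<pi> \<cdot> (\<iota> i \<cdot> h i) = (\<pi> \<cdot> \<iota> i) \<cdot> h i" if "i \<in> I" for i
      using cmp_assoc[OF hh coproduct_Hom(1)[OF P] \<pi>(1)] that by simp
    have "\<pi> \<cdot> ?\<phi> h = gfinprod (hom_group T A (X j)) (\<lambda>i. \<pi> \<cdot> (\<iota> i \<cdot> h i)) I"
      using cmp_gfinprod_left[OF \<pi>(1) A] comparison_terms[OF P A h] by blast
    also have "\<dots> = \<pi> \<cdot> (\<iota> j \<cdot> h j)"
    proof (rule gfinprod_Hom_single[OF j])
      show "\<pi> \<cdot> (\<iota> j \<cdot> h j) \<in> Hom T A (X j)"
        using cmp_Hom hh j coproduct_Hom(1)[OF P] \<pi>(1) by blast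
      show "\<pi> \<cdot> (\<iota> i \<cdot> h i) = zero_arr T A (X j)" if "i \<in> I" "i \<noteq> j" for i
        using as that \<pi>(3) cmp_zero_left[OF hh[OF that(1)] coproduct_Hom(2)[OF P j]] by simp
    qed
    also have "\<dots> = h j"
      using as[OF j] \<pi>(2) cmp_ident_left[OF hh[OF j]] by simp
    finally show ?thesis .
  qed
  show ?thesis
  proof (rule inj_onI)
    fix h h' assume h: "h \<in> carrier ?S" "h' \<in> carrier ?S" and eq: "?\<phi> h = ?\<phi> h'"
    \<comment> \<open>Projections recover \<open>h j\<close> only for \<open>j\<close> in
      \<open>I\<close>; outside \<open>I\<close> elements of the direct sum agree by
      convention.\<close>
    have "h \<in> extensional I" "h' \<in> extensional I"
      using h by (auto simp: sum_group_carrier[OF P A] PiE_def)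
    moreover have "h j = h' j" if j: "j \<in> I" for j
    proof (rule projection_ex[OF P j])
      fix \<pi> assume \<pi>: "\<pi> \<in> Hom T P (X j)" "\<pi> \<cdot> \<iota> j = ident T (X j)"
        "\<And>i. i \<in> I \<Longrightarrow> i \<noteq> j \<Longrightarrow> \<pi> \<cdot> \<iota> i = zero_arr T (X i) (X j)"
      show ?thesis
        using component[OF h(1) j \<pi>] component[OF h(2) j \<pi>] eq by simp
    qed
    ultimately show "h = h'"
      by (rule extensionalityI)
  qed
qed

text \<open>A finitely supported sum is fixed by the truncation at its support. Conversely a
  truncation at a finite \<open>F\<close> is the sum of the maps
  \<open>\<iota> i \<cdot> \<pi> i\<close> over \<open>F\<close>, so a morphism fixed by it is the
  sum of its injected components \<open>\<pi> i \<cdot> a\<close>.\<close>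

lemma comparison_range:
  assumes P: "is_coproduct T I X P \<iota>" and a: "a \<in> Hom T A P"
  shows "a \<in> (\<lambda>h. gfinprod (hom_group T A P) (\<lambda>i. \<iota> i \<cdot> h i) I) `
      carrier (sum_group I (\<lambda>i. hom_group T A (X i))) \<longleftrightarrow> factors_finitely I X P \<iota> a"
    (is "_ \<in> ?\<phi> ` carrier ?S \<longleftrightarrow> _")
proof
  have A: "A \<in> Obj T" and PO: "P \<in> Obj T"
    using Hom_Obj a by auto
  {
    assume "a \<in> ?\<phi> ` carrier ?S"
    then obtain h where h: "h \<in> carrier ?S" and a_eq: "a = ?\<phi> h"
      by blast
    define F where "F = {i \<in> I. h i \<noteq> zero_arr T A (X i)}"
    obtain e where e: "truncation I X P \<iota> F e"
      using truncation_ex[OF P] by blast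
    have hh: "h i \<in> Hom T A (X i)" if "i \<in> I" for i
      using h that by (auto simp: sum_group_carrier[OF P A])
    have eH: "e \<in> Hom T P P"
      using e by (simp add: truncation_def)
    have "e \<cdot> (\<iota> i \<cdot> h i) = \<iota> i \<cdot> h i" if i: "i \<in> I" for i
    proof -
      note as = cmp_assoc[OF hh[OF i] coproduct_Hom(1)[OF P i] eH]
      show ?thesis
      proof (cases "i \<in> F")
        case True
        then show ?thesis using as e i by (simp add: truncation_def)
      next
        case False
        then have "h i = zero_arr T A (X i)" using i by (simp add: F_def)
        then show ?thesis
          using cmp_zero_right[OF _ A] coproduct_Hom(1)[OF P i] eH by simp
      qed
    qed
    then have "e \<cdot> a = a"
      unfolding a_eq cmp_gfinprod_left[OF eH A comparison_terms[OF P A h]]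
      using comparison_terms(1)[OF P A h] by (intro gfinprod_Hom_cong A PO) auto
    moreover have "finite F" "F \<subseteq> I"
      using h by (auto simp: F_def sum_group_carrier[OF P A])
    ultimately show "factors_finitely I X P \<iota> a"
      using e by (auto simp: factors_finitely_def)
  }
  assume "factors_finitely I X P \<iota> a"
  then obtain F e where F: "finite F" "F \<subseteq> I" and e: "truncation I X P \<iota> F e" and ea: "e \<cdot> a = a"
    by (auto simp: factors_finitely_def)
  have eH: "e \<in> Hom T P P"
    using e by (simp add: truncation_def)
  have "\<exists>\<pi>. \<forall>j\<in>I. \<pi> j \<in> Hom T P (X j) \<and> \<pi> j \<cdot> \<iota> j = ident T (X j) \<and>
      (\<forall>i\<in>I. i \<noteq> j \<longrightarrow> \<pi> j \<cdot> \<iota> i = zero_arr T (X i) (X j))"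
  proof (rule bchoice, rule ballI)
    fix j assume "j \<in> I"
    then show "\<exists>\<pi>. \<pi> \<in> Hom T P (X j) \<and> \<pi> \<cdot> \<iota> j = ident T (X j) \<and>
        (\<forall>i\<in>I. i \<noteq> j \<longrightarrow> \<pi> \<cdot> \<iota> i = zero_arr T (X i) (X j))"
      by (rule projection_ex[OF P]) blast
  qed
  then obtain \<pi> where \<pi>: "\<And>j. j \<in> I \<Longrightarrow> \<pi> j \<in> Hom T P (X j)"
      "\<And>j. j \<in> I \<Longrightarrow> \<pi> j \<cdot> \<iota> j = ident T (X j)"
      "\<And>i j. j \<in> I \<Longrightarrow> i \<in> I \<Longrightarrow> i \<noteq> j \<Longrightarrow> \<pi> j \<cdot> \<iota> i = zero_arr T (X i) (X j)"
    by blast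
  \<comment> \<open>Cutting the projections off outside \<open>F\<close> yields a family on all of
    \<open>I\<close> with finite support, so every sum can run over \<open>I\<close>.\<close>
  define p where "p i = (if i \<in> F then \<pi> i else zero_arr T P (X i))" for i
  have p: "p i \<in> Hom T P (X i)" if "i \<in> I" for i
    using that \<pi>(1) zero_Hom PO coproduct_Hom(2)[OF P] by (simp add: p_def)
  define c where "c i = \<iota> i \<cdot> p i" for i
  have c: "c \<in> I \<rightarrow> Hom T P P"
    using cmp_Hom[OF p coproduct_Hom(1)[OF P]] by (simp add: c_def)
  have "{i \<in> I. c i \<noteq> zero_arr T P P} \<subseteq> F"
    using cmp_zero_right[OF coproduct_Hom(1)[OF P] PO] by (auto simp: c_def p_def)
  then have c_fin: "finite {i \<in> I. c i \<noteq> zero_arr T P P}"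
    using F finite_subset by blast
  \<comment> \<open>By uniqueness of maps out of \<open>P\<close> it suffices to compose with each
    \<open>\<iota> i\<close>, where only the term with index \<open>i\<close> can survive.\<close>
  have "gfinprod (hom_group T P P) c I = e"
  proof (rule coproduct_eqI[OF P gfinprod_Hom[OF PO PO c] eH])
    fix i assume i: "i \<in> I"
    note \<iota> = coproduct_Hom[OF P]
    have as: "c j \<cdot> \<iota> i = \<iota> j \<cdot> (p j \<cdot> \<iota> i)" if "j \<in> I" for j
      unfolding c_def using cmp_assoc[OF \<iota>(1)[OF i] p[OF that] \<iota>(1)[OF that]] .
    have "gfinprod (hom_group T P P) c I \<cdot> \<iota> i = gfinprod (hom_group T (X i) P) (\<lambda>j. c j \<cdot> \<iota> i) I"
      using cmp_gfinprod_right[OF \<iota>(1)[OF i] PO c c_fin] .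
    also have "\<dots> = c i \<cdot> \<iota> i"
    proof (rule gfinprod_Hom_single[OF i])
      show "c i \<cdot> \<iota> i \<in> Hom T (X i) P"
        using c i \<iota>(1) cmp_Hom by blast
      fix j assume j: "j \<in> I" "j \<noteq> i"
      have "p j \<cdot> \<iota> i = zero_arr T (X i) (X j)"
        using j i \<pi>(3)[of j i] cmp_zero_left[OF \<iota>(1)[OF i] \<iota>(2)[OF j(1)]] by (auto simp: p_def)
      then show "c j \<cdot> \<iota> i = zero_arr T (X i) P"
        using as[OF j(1)] cmp_zero_right[OF \<iota>(1)[OF j(1)] \<iota>(2)[OF i]] by simp
    qed
    also have "\<dots> = e \<cdot> \<iota> i"
      using as[OF i] e i \<pi>(2)[OF i] cmp_zero_left[OF \<iota>(1)[OF i] \<iota>(2)[OF i]]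
        cmp_zero_right[OF \<iota>(1)[OF i] \<iota>(2)[OF i]] cmp_ident_right[OF \<iota>(1)[OF i]]
      by (auto simp: truncation_def p_def)
    finally show "gfinprod (hom_group T P P) c I \<cdot> \<iota> i = e \<cdot> \<iota> i" .
  qed
  then have "a = gfinprod (hom_group T A P) (\<lambda>i. c i \<cdot> a) I"
    using cmp_gfinprod_right[OF a PO c c_fin] ea by simp
  \<comment> \<open>The components are restricted to \<open>I\<close> because elements of the direct
    sum are extensional.\<close>
  also have "\<dots> = ?\<phi> (\<lambda>i\<in>I. p i \<cdot> a)"
    using cmp_Hom[OF cmp_Hom[OF a p] coproduct_Hom(1)[OF P]] cmp_assoc[OF a p coproduct_Hom(1)[OF P]]
    by (intro gfinprod_Hom_cong A PO) (auto simp: c_def)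
  finally have "a = ?\<phi> (\<lambda>i\<in>I. p i \<cdot> a)" .
  moreover have "(\<lambda>i\<in>I. p i \<cdot> a) \<in> carrier ?S"
  proof -
    have "{i \<in> I. (\<lambda>i\<in>I. p i \<cdot> a) i \<noteq> zero_arr T A (X i)} \<subseteq> F"
      using cmp_zero_left[OF a] coproduct_Hom(2)[OF P] by (auto simp: p_def)
    then have "finite {i \<in> I. (\<lambda>i\<in>I. p i \<cdot> a) i \<noteq> zero_arr T A (X i)}"
      using F(1) by (rule finite_subset)
    then show ?thesis
      using cmp_Hom[OF a p] by (simp add: sum_group_carrier[OF P A])
  qed
  ultimately show "a \<in> ?\<phi> ` carrier ?S"
    by blast
qed

text \<open>The comparison map is always an injective homomorphism, so being an isomorphism is
  surjectivity, which \<open>comparison_range\<close> decides morphism by morphism.\<close>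

lemma compact_object_iff:
  "compact_object U T A \<longleftrightarrow> A \<in> Obj T \<and>
     (\<forall>(I :: 'u set) X P \<iota>. small (U :: 'u itself) I \<and> is_coproduct T I X P \<iota> \<longrightarrow>
        (\<forall>a \<in> Hom T A P. factors_finitely I X P \<iota> a))"
proof (cases "A \<in> Obj T")
  case True
  have "(\<lambda>h. gfinprod (hom_group T A P) (\<lambda>i. \<iota> i \<cdot> h i) I)
        \<in> iso (sum_group I (\<lambda>i. hom_group T A (X i))) (hom_group T A P) \<longleftrightarrow>
      (\<forall>a \<in> Hom T A P. factors_finitely I X P \<iota> a)"
    (is "?\<phi> \<in> iso ?S ?H \<longleftrightarrow> _")
    if P: "is_coproduct T I X P \<iota>" for I :: "'u set" and X P \<iota>
  proof -
    have "?\<phi> \<in> iso ?S ?H \<longleftrightarrow> ?\<phi> ` carrier ?S = Hom T A P"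
      using comparison_hom[OF P True] comparison_inj[OF P True]
      by (auto simp: iso_def bij_betw_def hom_group_def)
    also have "\<dots> \<longleftrightarrow> Hom T A P \<subseteq> ?\<phi> ` carrier ?S"
      using comparison_hom[OF P True] by (auto simp: hom_def hom_group_def)
    also have "\<dots> \<longleftrightarrow> (\<forall>a \<in> Hom T A P. factors_finitely I X P \<iota> a)"
      using comparison_range[OF P] by blast
    finally show ?thesis .
  qed
  then show ?thesis
    unfolding compact_object_def by blast
qed (simp add: compact_object_def)

text \<open>A morphism out of \<open>Q\<close> is determined by its composites with \<open>i\<close>
  and \<open>i'\<close>. A truncation at the union of their finite supports fixes both, hence the
  morphism.\<close>

lemma biproduct_compact:
  fixes U :: "'u itself"
  assumes Q: "is_biproduct T B B' Q i i' p p'"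
    and B: "compact_object U T B" and B': "compact_object U T B'"
  shows "compact_object U T Q"
  unfolding compact_object_iff
proof (intro conjI allI impI ballI)
  have h: "i \<in> Hom T B Q" "i' \<in> Hom T B' Q" "p \<in> Hom T Q B" "p' \<in> Hom T Q B'"
    and id: "(i \<cdot> p) \<boxplus> (i' \<cdot> p') = ident T Q"
    using Q by (auto simp: is_biproduct_def)
  show "Q \<in> Obj T" using Hom_Obj h by blast
  fix I :: "'u set" and X P \<iota> a
  assume I: "small U I \<and> is_coproduct T I X P \<iota>" and a: "a \<in> Hom T Q P"
  then have P: "is_coproduct T I X P \<iota>" by simp
  have ai: "a \<cdot> i \<in> Hom T B P" "a \<cdot> i' \<in> Hom T B' P"
    using cmp_Hom a h by blast+
  then have "factors_finitely I X P \<iota> (a \<cdot> i)" "factors_finitely I X P \<iota> (a \<cdot> i')"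
    using I B B' by (auto simp: compact_object_iff)
  then obtain F e F' e' where F: "finite F" "F \<subseteq> I" "truncation I X P \<iota> F e" "e \<cdot> (a \<cdot> i) = a \<cdot> i"
    and F': "finite F'" "F' \<subseteq> I" "truncation I X P \<iota> F' e'" "e' \<cdot> (a \<cdot> i') = a \<cdot> i'"
    by (auto simp: factors_finitely_def)
  obtain k where k: "truncation I X P \<iota> (F \<union> F') k"
    using truncation_ex[OF P] by blast
  then have kH: "k \<in> Hom T P P" by (simp add: truncation_def)
  have "k \<cdot> (a \<cdot> i) = a \<cdot> i" "k \<cdot> (a \<cdot> i') = a \<cdot> i'"
    using truncation_fixes_mono[OF P _ F(3) k ai(1) F(4)]
      truncation_fixes_mono[OF P _ F'(3) k ai(2) F'(4)] by auto
  then have ka: "(k \<cdot> a) \<cdot> i = a \<cdot> i" "(k \<cdot> a) \<cdot> i' = a \<cdot> i'"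
    using cmp_assoc[OF h(1) a kH] cmp_assoc[OF h(2) a kH] by auto
  \<comment> \<open>Composing \<open>b\<close> with the decomposition of the identity of
    \<open>Q\<close> rebuilds it from its two restrictions.\<close>
  have expand: "((b \<cdot> i) \<cdot> p) \<boxplus> ((b \<cdot> i') \<cdot> p') = b" if b: "b \<in> Hom T Q P" for b
    using cmp_add_right[OF cmp_Hom[OF h(3) h(1)] cmp_Hom[OF h(4) h(2)] b] id
      cmp_ident_right[OF b] cmp_assoc[OF h(3) h(1) b] cmp_assoc[OF h(4) h(2) b] by simp
  have "k \<cdot> a = (((k \<cdot> a) \<cdot> i) \<cdot> p) \<boxplus> (((k \<cdot> a) \<cdot> i') \<cdot> p')"
    by (rule expand[OF cmp_Hom[OF a kH], symmetric])
  also have "\<dots> = a"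
    unfolding ka by (rule expand[OF a])
  finally show "factors_finitely I X P \<iota> a"
    unfolding factors_finitely_def using F(1,2) F'(1,2) k by blast
qed

end

section \<open>Compactness in triangulated categories\<close>

lemma (in category) iso_objE:
  assumes "iso_obj T A B"
  obtains s t where "s \<in> Hom T A B" "t \<in> Hom T B A" "t \<cdot> s = ident T A" "s \<cdot> t = ident T B"
  using assms by (auto simp: iso_obj_def iso_arr_def Hom_def)

text \<open>Separates existence of extensions from joint cancellability of the injections, since the
  two are transported along the shift by different arguments.\<close>

lemma (in category) coproductI:
  assumes "X \<in> I \<rightarrow> Obj T" "P \<in> Obj T" "\<And>i. i \<in> I \<Longrightarrow> \<iota> i \<in> Hom T (X i) P"
    and "\<And>Y h. Y \<in> Obj T \<Longrightarrow> (\<And>i. i \<in> I \<Longrightarrow> h i \<in> Hom T (X i) Y) \<Longrightarrow>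
      \<exists>k \<in> Hom T P Y. \<forall>i\<in>I. k \<cdot> \<iota> i = h i"
    and unique: "\<And>Y k l. k \<in> Hom T P Y \<Longrightarrow> l \<in> Hom T P Y \<Longrightarrow>
      (\<And>i. i \<in> I \<Longrightarrow> k \<cdot> \<iota> i = l \<cdot> \<iota> i) \<Longrightarrow> k = l"
  shows "is_coproduct T I X P \<iota>"
  unfolding is_coproduct_def
proof (intro conjI ballI allI impI)
  fix Y h assume Y: "Y \<in> Obj T" and h: "\<forall>i\<in>I. h i \<in> Hom T (X i) Y"
  obtain k where k: "k \<in> Hom T P Y" "\<forall>i\<in>I. k \<cdot> \<iota> i = h i"
    using assms(4)[OF Y, of h] h by blast
  then show "\<exists>!k. k \<in> Hom T P Y \<and> (\<forall>i\<in>I. k \<cdot> \<iota> i = h i)"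
  proof (intro ex1I[of _ k] conjI)
    fix l assume l: "l \<in> Hom T P Y \<and> (\<forall>i\<in>I. l \<cdot> \<iota> i = h i)"
    show "l = k"
      by (rule unique[of l Y k]) (use k l in simp_all)
  qed auto
qed (use assms(1-3) in auto)

context triangulated_category
begin

section \<open>The shift: coproducts, truncations and compactness\<close>

lemma shift_Hom: "f \<in> Hom T A B \<Longrightarrow> shift_arr T f \<in> Hom T (shift_obj T A) (shift_obj T B)"
  using shift_fully_faithful Hom_Obj by (blast dest: bij_betw_apply)

lemma shift_inj:
  "f \<in> Hom T A B \<Longrightarrow> g \<in> Hom T A B \<Longrightarrow> shift_arr T f = shift_arr T g \<Longrightarrow> f = g"
  using shift_fully_faithful[of A B] Hom_Obj[of f A B] by (auto simp: bij_betw_def dest: inj_onD)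

lemma shift_surj:
  assumes "A \<in> Obj T" "B \<in> Obj T" "k \<in> Hom T (shift_obj T A) (shift_obj T B)"
  shows "\<exists>f \<in> Hom T A B. shift_arr T f = k"
proof -
  have "k \<in> shift_arr T ` Hom T A B"
    using shift_fully_faithful[OF assms(1,2)] assms(3) by (simp add: bij_betw_def)
  then show ?thesis by blast
qed

lemma shift_zero:
  assumes "A \<in> Obj T" "B \<in> Obj T"
  shows "shift_arr T (zero_arr T A B) = zero_arr T (shift_obj T A) (shift_obj T B)"
proof (rule add_right_cancel)
  note z = zero_Hom[OF assms]
  show s: "shift_arr T (zero_arr T A B) \<in> Hom T (shift_obj T A) (shift_obj T B)"
    using shift_Hom[OF z] .
  then show "shift_arr T (zero_arr T A B) \<in> Hom T (shift_obj T A) (shift_obj T B)" .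
  show "zero_arr T (shift_obj T A) (shift_obj T B) \<in> Hom T (shift_obj T A) (shift_obj T B)"
    using zero_Hom shift_obj assms by blast
  show "shift_arr T (zero_arr T A B) \<boxplus> shift_arr T (zero_arr T A B) =
      zero_arr T (shift_obj T A) (shift_obj T B) \<boxplus> shift_arr T (zero_arr T A B)"
    using shift_add[OF z z] zero_add[OF z] zero_add[OF s] by simp
qed

text \<open>The substitute for an inverse of the shift: every object is a shifted one up to the
  explicit isomorphism \<open>s\<close>, \<open>t\<close>.\<close>

lemma shift_iso_ex:
  assumes "B \<in> Obj T"
  obtains A s t where "A \<in> Obj T" "s \<in> Hom T (shift_obj T A) B" "t \<in> Hom T B (shift_obj T A)"
    "t \<cdot> s = ident T (shift_obj T A)" "s \<cdot> t = ident T B"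
proof -
  obtain A where A: "A \<in> Obj T" "iso_obj T (shift_obj T A) B"
    using shift_ess_surj[OF assms] by blast
  from A(2) show thesis
    by (rule iso_objE) (rule that[OF A(1)])
qed

text \<open>A test object \<open>Y\<close> is replaced by some \<Sigma>W isomorphic to it. Fullness
  turns a family into \<Sigma>W into one into \<open>W\<close>, where the coproduct \<open>P\<close>
  extends it; shifting and composing with \<open>s\<close> returns to \<open>Y\<close>.\<close>

lemma shift_coproduct:
  assumes P: "is_coproduct T I X P \<iota>"
  shows "is_coproduct T I (\<lambda>i. shift_obj T (X i)) (shift_obj T P) (\<lambda>i. shift_arr T (\<iota> i))"
proof -
  note \<iota> = coproduct_Hom(1,2)[OF P]
  have PO: "P \<in> Obj T"
    using P by (simp add: is_coproduct_def)
  show ?thesis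
  proof (rule coproductI)
    show "(\<lambda>i. shift_obj T (X i)) \<in> I \<rightarrow> Obj T" "shift_obj T P \<in> Obj T"
      using shift_obj \<iota>(2) PO by auto
    show "shift_arr T (\<iota> i) \<in> Hom T (shift_obj T (X i)) (shift_obj T P)" if "i \<in> I" for i
      using shift_Hom[OF \<iota>(1)[OF that]] .
  next
    fix Y h assume Y: "Y \<in> Obj T"
      and h: "\<And>i. i \<in> I \<Longrightarrow> h i \<in> Hom T (shift_obj T (X i)) Y"
    obtain W s t where W: "W \<in> Obj T" and st: "s \<in> Hom T (shift_obj T W) Y"
        "t \<in> Hom T Y (shift_obj T W)" "s \<cdot> t = ident T Y"
      by (rule shift_iso_ex[OF Y])
    have "\<forall>i\<in>I. \<exists>g. g \<in> Hom T (X i) W \<and> shift_arr T g = t \<cdot> h i"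
      using shift_surj[OF \<iota>(2) W cmp_Hom[OF h st(2)]] by blast
    from bchoice[OF this] obtain g where g: "\<And>i. i \<in> I \<Longrightarrow> g i \<in> Hom T (X i) W"
        "\<And>i. i \<in> I \<Longrightarrow> shift_arr T (g i) = t \<cdot> h i"
      by blast
    obtain k where k: "k \<in> Hom T P W" "\<forall>i\<in>I. k \<cdot> \<iota> i = g i"
      using coproduct_ex[OF P W, of g] g(1) by blast
    show "\<exists>k\<in>Hom T (shift_obj T P) Y. \<forall>i\<in>I. k \<cdot> shift_arr T (\<iota> i) = h i"
    proof (intro bexI[of _ "s \<cdot> shift_arr T k"] ballI)
      fix i assume i: "i \<in> I"
      have "(s \<cdot> shift_arr T k) \<cdot> shift_arr T (\<iota> i) = s \<cdot> (shift_arr T k \<cdot> shift_arr T (\<iota> i))"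
        using cmp_assoc[OF shift_Hom[OF \<iota>(1)[OF i]] shift_Hom[OF k(1)] st(1)] .
      also have "\<dots> = s \<cdot> (t \<cdot> h i)"
        using shift_cmp[OF \<iota>(1)[OF i] k(1)] k(2) g(2) i by simp
      also have "\<dots> = h i"
        using cmp_assoc[OF h[OF i] st(2,1)] st(3) cmp_ident_left[OF h[OF i]] by simp
      finally show "(s \<cdot> shift_arr T k) \<cdot> shift_arr T (\<iota> i) = h i" .
    next
      show "s \<cdot> shift_arr T k \<in> Hom T (shift_obj T P) Y"
        using cmp_Hom[OF shift_Hom[OF k(1)] st(1)] .
    qed
  next
    fix Y k l assume k: "k \<in> Hom T (shift_obj T P) Y" and l: "l \<in> Hom T (shift_obj T P) Y"
      and eq: "\<And>i. i \<in> I \<Longrightarrow> k \<cdot> shift_arr T (\<iota> i) = l \<cdot> shift_arr T (\<iota> i)"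
    obtain W s t where W: "W \<in> Obj T" and st: "s \<in> Hom T (shift_obj T W) Y"
        "t \<in> Hom T Y (shift_obj T W)" "s \<cdot> t = ident T Y"
      by (rule shift_iso_ex[of Y]) (use Hom_Obj[OF k] in auto)
    \<comment> \<open>For uniqueness both maps are desuspended and compared on \<open>P\<close> by
      faithfulness; \<open>s\<close> then cancels \<open>t\<close>.\<close>
    obtain k' where k': "k' \<in> Hom T P W" "shift_arr T k' = t \<cdot> k"
      using shift_surj[OF PO W cmp_Hom[OF k st(2)]] by blast
    obtain l' where l': "l' \<in> Hom T P W" "shift_arr T l' = t \<cdot> l"
      using shift_surj[OF PO W cmp_Hom[OF l st(2)]] by blast
    have "k' = l'"
    proof (rule coproduct_eqI[OF P k'(1) l'(1)])
      fix i assume i: "i \<in> I"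
      note si = shift_Hom[OF \<iota>(1)[OF i]]
      have "shift_arr T (k' \<cdot> \<iota> i) = shift_arr T (l' \<cdot> \<iota> i)"
        using shift_cmp[OF \<iota>(1)[OF i] k'(1)] shift_cmp[OF \<iota>(1)[OF i] l'(1)] k'(2) l'(2)
          cmp_assoc[OF si k st(2)] cmp_assoc[OF si l st(2)] eq[OF i] by simp
      then show "k' \<cdot> \<iota> i = l' \<cdot> \<iota> i"
        using shift_inj cmp_Hom[OF \<iota>(1)[OF i] k'(1)] cmp_Hom[OF \<iota>(1)[OF i] l'(1)] by blast
    qed
    then have "s \<cdot> (t \<cdot> k) = s \<cdot> (t \<cdot> l)"
      using k' l' by simp
    then show "k = l"
      using cmp_assoc[OF k st(2,1)] cmp_assoc[OF l st(2,1)] st(3) cmp_ident_left[OF k]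
        cmp_ident_left[OF l] by simp
  qed
qed

lemma shift_truncation:
  assumes P: "is_coproduct T I X P \<iota>" and e: "truncation I X P \<iota> F e"
  shows "truncation I (\<lambda>i. shift_obj T (X i)) (shift_obj T P) (\<lambda>i. shift_arr T (\<iota> i)) F (shift_arr T e)"
  unfolding truncation_def
proof (intro conjI ballI)
  have eH: "e \<in> Hom T P P"
    using e by (simp add: truncation_def)
  then show "shift_arr T e \<in> Hom T (shift_obj T P) (shift_obj T P)"
    by (rule shift_Hom)
  fix i assume i: "i \<in> I"
  have "shift_arr T e \<cdot> shift_arr T (\<iota> i) = shift_arr T (e \<cdot> \<iota> i)"
    using shift_cmp[OF coproduct_Hom(1)[OF P i] eH] by simp
  also have "\<dots> = (if i \<in> F then shift_arr T (\<iota> i) else zero_arr T (shift_obj T (X i)) (shift_obj T P))"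
    using e i shift_zero[OF coproduct_Hom(2,3)[OF P i]] by (simp add: truncation_def)
  finally show "shift_arr T e \<cdot> shift_arr T (\<iota> i) =
      (if i \<in> F then shift_arr T (\<iota> i) else zero_arr T (shift_obj T (X i)) (shift_obj T P))" .
qed

text \<open>The shifted morphism factors finitely through the shifted coproduct, and faithfulness
  brings the equation back.\<close>

lemma compact_unshift:
  fixes U :: "'u itself"
  assumes A: "A \<in> Obj T" and compact: "compact_object U T (shift_obj T A)"
  shows "compact_object U T A"
  unfolding compact_object_iff
proof (intro conjI allI impI ballI A)
  fix I :: "'u set" and X P \<iota> a
  assume I: "small U I \<and> is_coproduct T I X P \<iota>" and a: "a \<in> Hom T A P"
  then have P: "is_coproduct T I X P \<iota>" by simp
  note SP = shift_coproduct[OF P]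
  have "factors_finitely I (\<lambda>i. shift_obj T (X i)) (shift_obj T P) (\<lambda>i. shift_arr T (\<iota> i)) (shift_arr T a)"
    using compact I SP shift_Hom[OF a] by (simp add: compact_object_iff)
  then obtain F e where F: "finite F" "F \<subseteq> I"
    and e: "truncation I (\<lambda>i. shift_obj T (X i)) (shift_obj T P) (\<lambda>i. shift_arr T (\<iota> i)) F e"
      "e \<cdot> shift_arr T a = shift_arr T a"
    unfolding factors_finitely_def by blast
  obtain k where k: "truncation I X P \<iota> F k"
    using truncation_ex[OF P] by blast
  then have kH: "k \<in> Hom T P P" by (simp add: truncation_def)
  \<comment> \<open>The truncation \<open>e\<close> is not given as a shift, so it is exchanged for
    the shift of a truncation \<open>k\<close> at the same \<open>F\<close>.\<close>
  have "shift_arr T k \<cdot> shift_arr T a = shift_arr T a"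
    using truncation_fixes_mono[OF SP order.refl e(1) shift_truncation[OF P k] shift_Hom[OF a] e(2)] .
  then have "k \<cdot> a = a"
    using shift_inj[OF cmp_Hom[OF a kH] a] shift_cmp[OF a kH] by simp
  then show "factors_finitely I X P \<iota> a"
    unfolding factors_finitely_def using F k by blast
qed

text \<open>Desuspends a coproduct diagram up to isomorphism: the shifts of \<open>Y i\<close> and
  \<open>Q\<close> are identified with \<open>X i\<close> and \<open>P\<close>, compatibly with the
  injections. Compactness of an object can then be applied to \<open>Q\<close> in order to treat its
  shift.\<close>

lemma unshift_coproduct:
  assumes P: "is_coproduct T I X P \<iota>"
  obtains Y Q \<kappa> s t \<tau> where "is_coproduct T I Y Q \<kappa>"
    "s \<in> Hom T (shift_obj T Q) P" "t \<in> Hom T P (shift_obj T Q)" "s \<cdot> t = ident T P"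
    "\<forall>i\<in>I. \<tau> i \<in> Hom T (X i) (shift_obj T (Y i))"
    "\<forall>i\<in>I. shift_arr T (\<kappa> i) \<cdot> \<tau> i = t \<cdot> \<iota> i"
proof -
  note \<iota> = coproduct_Hom(1,2)[OF P]
  have PO: "P \<in> Obj T"
    using P by (simp add: is_coproduct_def)
  obtain Q s t where Q: "Q \<in> Obj T" and st: "s \<in> Hom T (shift_obj T Q) P"
      "t \<in> Hom T P (shift_obj T Q)" "t \<cdot> s = ident T (shift_obj T Q)" "s \<cdot> t = ident T P"
    by (rule shift_iso_ex[OF PO])
  \<comment> \<open>The object and both directions of its isomorphism are packed into one triple, so
    that a single choice over \<open>I\<close> picks them together.\<close>
  have "\<exists>z. fst z \<in> Obj T \<and> fst (snd z) \<in> Hom T (shift_obj T (fst z)) (X i) \<and>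
      snd (snd z) \<in> Hom T (X i) (shift_obj T (fst z)) \<and>
      snd (snd z) \<cdot> fst (snd z) = ident T (shift_obj T (fst z)) \<and>
      fst (snd z) \<cdot> snd (snd z) = ident T (X i)" if "i \<in> I" for i
  proof (rule shift_iso_ex[OF \<iota>(2)[OF that]])
    fix A s t assume "A \<in> Obj T" "s \<in> Hom T (shift_obj T A) (X i)" "t \<in> Hom T (X i) (shift_obj T A)"
      "t \<cdot> s = ident T (shift_obj T A)" "s \<cdot> t = ident T (X i)"
    then show ?thesis
      by (intro exI[of _ "(A, s, t)"]) simp
  qed
  then have "\<forall>i\<in>I. \<exists>z. fst z \<in> Obj T \<and> fst (snd z) \<in> Hom T (shift_obj T (fst z)) (X i) \<and>
      snd (snd z) \<in> Hom T (X i) (shift_obj T (fst z)) \<and>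
      snd (snd z) \<cdot> fst (snd z) = ident T (shift_obj T (fst z)) \<and>
      fst (snd z) \<cdot> snd (snd z) = ident T (X i)"
    by blast
  from bchoice[OF this] obtain z where z: "\<And>i. i \<in> I \<Longrightarrow> fst (z i) \<in> Obj T \<and>
      fst (snd (z i)) \<in> Hom T (shift_obj T (fst (z i))) (X i) \<and>
      snd (snd (z i)) \<in> Hom T (X i) (shift_obj T (fst (z i))) \<and>
      snd (snd (z i)) \<cdot> fst (snd (z i)) = ident T (shift_obj T (fst (z i))) \<and>
      fst (snd (z i)) \<cdot> snd (snd (z i)) = ident T (X i)"
    by blast
  define Y \<sigma> \<tau> where "Y i = fst (z i)" and "\<sigma> i = fst (snd (z i))" and "\<tau> i = snd (snd (z i))" for i
  have Y: "Y i \<in> Obj T" and \<sigma>: "\<sigma> i \<in> Hom T (shift_obj T (Y i)) (X i)"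
    and \<tau>: "\<tau> i \<in> Hom T (X i) (shift_obj T (Y i))"
    and \<tau>\<sigma>: "\<tau> i \<cdot> \<sigma> i = ident T (shift_obj T (Y i))"
    and \<sigma>\<tau>: "\<sigma> i \<cdot> \<tau> i = ident T (X i)" if "i \<in> I" for i
    using z[OF that] by (auto simp: Y_def \<sigma>_def \<tau>_def)
  have ti: "t \<cdot> \<iota> i \<in> Hom T (X i) (shift_obj T Q)" if "i \<in> I" for i
    using cmp_Hom[OF \<iota>(1)[OF that] st(2)] .
  \<comment> \<open>The injections of the desuspended diagram: \<open>\<iota> i\<close> conjugated
    by the isomorphisms is a map between shifts, and fullness provides a preimage.\<close>
  have "\<forall>i\<in>I. \<exists>g. g \<in> Hom T (Y i) Q \<and> shift_arr T g = (t \<cdot> \<iota> i) \<cdot> \<sigma> i"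
    using shift_surj[OF Y Q cmp_Hom[OF \<sigma> ti]] by blast
  from bchoice[OF this] obtain \<kappa> where \<kappa>: "\<And>i. i \<in> I \<Longrightarrow> \<kappa> i \<in> Hom T (Y i) Q"
      "\<And>i. i \<in> I \<Longrightarrow> shift_arr T (\<kappa> i) = (t \<cdot> \<iota> i) \<cdot> \<sigma> i"
    by blast
  have \<kappa>\<tau>: "shift_arr T (\<kappa> i) \<cdot> \<tau> i = t \<cdot> \<iota> i" if i: "i \<in> I" for i
    using \<kappa>(2)[OF i] cmp_assoc[OF \<tau>[OF i] \<sigma>[OF i] ti[OF i]] \<sigma>\<tau>[OF i] cmp_ident_right[OF ti[OF i]]
    by simp
  have "is_coproduct T I Y Q \<kappa>"
  proof (rule coproductI)
    fix W h assume W: "W \<in> Obj T" and h: "\<And>i. i \<in> I \<Longrightarrow> h i \<in> Hom T (Y i) W"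
    have "shift_arr T (h i) \<cdot> \<tau> i \<in> Hom T (X i) (shift_obj T W)" if "i \<in> I" for i
      using cmp_Hom[OF \<tau> shift_Hom[OF h]] that by blast
    from coproduct_ex[OF P shift_obj[OF W], of "\<lambda>i. shift_arr T (h i) \<cdot> \<tau> i", OF this]
    obtain k where k: "k \<in> Hom T P (shift_obj T W)"
        "\<And>i. i \<in> I \<Longrightarrow> k \<cdot> \<iota> i = shift_arr T (h i) \<cdot> \<tau> i"
      by blast
    obtain l where l: "l \<in> Hom T Q W" "shift_arr T l = k \<cdot> s"
      using shift_surj[OF Q W cmp_Hom[OF st(1) k(1)]] by blast
    have lt: "shift_arr T l \<cdot> t = k"
      using l(2) cmp_assoc[OF st(2,1) k(1)] st(4) cmp_ident_right[OF k(1)] by simp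
    show "\<exists>k\<in>Hom T Q W. \<forall>i\<in>I. k \<cdot> \<kappa> i = h i"
    proof (intro bexI[OF _ l(1)] ballI)
      fix i assume i: "i \<in> I"
      have "shift_arr T (l \<cdot> \<kappa> i) = shift_arr T l \<cdot> ((t \<cdot> \<iota> i) \<cdot> \<sigma> i)"
        using shift_cmp[OF \<kappa>(1)[OF i] l(1)] \<kappa>(2)[OF i] by simp
      also have "\<dots> = (shift_arr T l \<cdot> (t \<cdot> \<iota> i)) \<cdot> \<sigma> i"
        using cmp_assoc[OF \<sigma>[OF i] ti[OF i] shift_Hom[OF l(1)]] by simp
      also have "shift_arr T l \<cdot> (t \<cdot> \<iota> i) = k \<cdot> \<iota> i"
        using cmp_assoc[OF \<iota>(1)[OF i] st(2) shift_Hom[OF l(1)]] lt by simp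
      also have "(k \<cdot> \<iota> i) \<cdot> \<sigma> i = shift_arr T (h i)"
        using k(2)[OF i] cmp_assoc[OF \<sigma>[OF i] \<tau>[OF i] shift_Hom[OF h[OF i]]] \<tau>\<sigma>[OF i]
          cmp_ident_right[OF shift_Hom[OF h[OF i]]] by simp
      finally show "l \<cdot> \<kappa> i = h i"
        by (rule shift_inj[OF cmp_Hom[OF \<kappa>(1)[OF i] l(1)] h[OF i]])
    qed
  next
    fix W k l assume k: "k \<in> Hom T Q W" and l: "l \<in> Hom T Q W"
      and eq: "\<And>i. i \<in> I \<Longrightarrow> k \<cdot> \<kappa> i = l \<cdot> \<kappa> i"
    \<comment> \<open>Transfers agreement on the \<open>\<kappa> i\<close> to agreement on the
      \<open>\<iota> i\<close>, where uniqueness for \<open>P\<close> applies.\<close>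
    have *: "(shift_arr T m \<cdot> t) \<cdot> \<iota> i = shift_arr T (m \<cdot> \<kappa> i) \<cdot> \<tau> i"
      if "m \<in> Hom T Q W" and i: "i \<in> I" for m i
      using cmp_assoc[OF \<iota>(1)[OF i] st(2) shift_Hom[OF that(1)]] \<kappa>\<tau>[OF i]
        cmp_assoc[OF \<tau>[OF i] shift_Hom[OF \<kappa>(1)[OF i]] shift_Hom[OF that(1)]]
        shift_cmp[OF \<kappa>(1)[OF i] that(1)] by simp
    have "shift_arr T k \<cdot> t = shift_arr T l \<cdot> t"
    proof (rule coproduct_eqI[OF P cmp_Hom[OF st(2) shift_Hom[OF k]] cmp_Hom[OF st(2) shift_Hom[OF l]]])
      fix i assume i: "i \<in> I"
      show "(shift_arr T k \<cdot> t) \<cdot> \<iota> i = (shift_arr T l \<cdot> t) \<cdot> \<iota> i"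
        unfolding *[OF k i] *[OF l i] eq[OF i] ..
    qed
    moreover have "(shift_arr T m \<cdot> t) \<cdot> s = shift_arr T m" if "m \<in> Hom T Q W" for m
      using cmp_assoc[OF st(1,2) shift_Hom[OF that]] st(3) cmp_ident_right[OF shift_Hom[OF that]] by simp
    ultimately have "shift_arr T k = shift_arr T l"
      using k l by metis
    then show "k = l"
      by (rule shift_inj[OF k l])
  qed (use Y Q \<kappa>(1) in auto)
  then show thesis
    by (rule that[of Y Q \<kappa> s t \<tau>]) (use st \<tau> \<kappa>\<tau> in simp_all)
qed

text \<open>Since the target is an arbitrary coproduct and not a shifted one, the coproduct is
  desuspended first. Then \<open>t \<cdot> a\<close> is the shift of some \<open>c\<close> out of
  \<open>A\<close>, and compactness of \<open>A\<close> applies to \<open>c\<close>.\<close>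

lemma compact_shift:
  fixes U :: "'u itself"
  assumes compact: "compact_object U T A"
  shows "compact_object U T (shift_obj T A)"
  unfolding compact_object_iff
proof (intro conjI allI impI ballI)
  have A: "A \<in> Obj T"
    using compact by (simp add: compact_object_def)
  then show "shift_obj T A \<in> Obj T"
    by (rule shift_obj)
  fix I :: "'u set" and X P \<iota> a
  assume I: "small U I \<and> is_coproduct T I X P \<iota>" and a: "a \<in> Hom T (shift_obj T A) P"
  then have P: "is_coproduct T I X P \<iota>" by simp
  note \<iota> = coproduct_Hom(1,2)[OF P]
  obtain Y Q \<kappa> s t \<tau> where Q: "is_coproduct T I Y Q \<kappa>"
    and st: "s \<in> Hom T (shift_obj T Q) P" "t \<in> Hom T P (shift_obj T Q)" "s \<cdot> t = ident T P"
    and \<tau>_all: "\<forall>i\<in>I. \<tau> i \<in> Hom T (X i) (shift_obj T (Y i))"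
    and \<kappa>\<tau>_all: "\<forall>i\<in>I. shift_arr T (\<kappa> i) \<cdot> \<tau> i = t \<cdot> \<iota> i"
    by (rule unshift_coproduct[OF P])
  note \<tau> = \<tau>_all[rule_format] and \<kappa>\<tau> = \<kappa>\<tau>_all[rule_format]
  have QO: "Q \<in> Obj T"
    using Q by (simp add: is_coproduct_def)
  obtain c where c: "c \<in> Hom T A Q" "shift_arr T c = t \<cdot> a"
    using shift_surj[OF A QO cmp_Hom[OF a st(2)]] by blast
  have "factors_finitely I Y Q \<kappa> c"
    using compact I Q c(1) by (simp add: compact_object_iff)
  then obtain F e where F: "finite F" "F \<subseteq> I" and e: "truncation I Y Q \<kappa> F e" "e \<cdot> c = c"
    unfolding factors_finitely_def by blast
  have eH: "e \<in> Hom T Q Q"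
    using e by (simp add: truncation_def)
  \<comment> \<open>The truncation of \<open>Q\<close>, shifted and conjugated to an endomorphism of
    \<open>P\<close>; it truncates \<open>P\<close> at the same \<open>F\<close>.\<close>
  define k where "k = s \<cdot> (shift_arr T e \<cdot> t)"
  note et = cmp_Hom[OF st(2) shift_Hom[OF eH]]
  have stx: "s \<cdot> (t \<cdot> x) = x" if "x \<in> Hom T Z P" for x Z
    using cmp_assoc[OF that st(2,1)] st(3) cmp_ident_left[OF that] by simp
  have kx: "k \<cdot> x = s \<cdot> (shift_arr T e \<cdot> (t \<cdot> x))" if "x \<in> Hom T Z P" for x Z
    unfolding k_def using cmp_assoc[OF that et st(1)] cmp_assoc[OF that st(2) shift_Hom[OF eH]] by simp
  have "truncation I X P \<iota> F k"
    unfolding truncation_def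
  proof (intro conjI ballI)
    show "k \<in> Hom T P P"
      unfolding k_def using cmp_Hom[OF et st(1)] .
    fix i assume i: "i \<in> I"
    note \<kappa> = coproduct_Hom(1,2)[OF Q i]
    have PO: "P \<in> Obj T"
      using P by (simp add: is_coproduct_def)
    have "k \<cdot> \<iota> i = s \<cdot> (shift_arr T e \<cdot> (shift_arr T (\<kappa> i) \<cdot> \<tau> i))"
      using kx[OF \<iota>(1)[OF i]] \<kappa>\<tau>[OF i] by simp
    also have "\<dots> = s \<cdot> (shift_arr T (e \<cdot> \<kappa> i) \<cdot> \<tau> i)"
      using cmp_assoc[OF \<tau>[OF i] shift_Hom[OF \<kappa>(1)] shift_Hom[OF eH]] shift_cmp[OF \<kappa>(1) eH] by simp
    also have "\<dots> = (if i \<in> F then \<iota> i else zero_arr T (X i) P)"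
    proof (cases "i \<in> F")
      case True
      then show ?thesis
        using e i \<kappa>\<tau>[OF i] stx[OF \<iota>(1)[OF i]] by (simp add: truncation_def)
    next
      case False
      then show ?thesis
        using e i shift_zero[OF \<kappa>(2) QO] cmp_zero_left[OF \<tau>[OF i] shift_obj[OF QO]]
          cmp_zero_right[OF st(1) \<iota>(2)[OF i]] by (simp add: truncation_def)
    qed
    finally show "k \<cdot> \<iota> i = (if i \<in> F then \<iota> i else zero_arr T (X i) P)" .
  qed
  moreover have "k \<cdot> a = a"
    using kx[OF a] c(2) shift_cmp[OF c(1) eH] e(2) stx[OF a] by simp
  ultimately show "factors_finitely I X P \<iota> a"
    unfolding factors_finitely_def using F by blast
qed

section \<open>Zero objects and weak exactness of triangles\<close>

lemma zero_objectI:
  assumes "Z \<in> Obj T" "ident T Z = zero_arr T Z Z"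
  shows "zero_object T Z"
  unfolding zero_object_def
proof (intro conjI ballI)
  fix A assume A: "A \<in> Obj T"
  have "f = zero_arr T Z A" if "f \<in> Hom T Z A" for f
    using cmp_ident_right[OF that] cmp_zero_right[OF that assms(1)] assms(2) by simp
  then show "\<exists>!f. f \<in> Hom T Z A"
    using zero_Hom[OF assms(1) A] by blast
  have "f = zero_arr T A Z" if "f \<in> Hom T A Z" for f
    using cmp_ident_left[OF that] cmp_zero_left[OF that assms(1)] assms(2) by simp
  then show "\<exists>!f. f \<in> Hom T A Z"
    using zero_Hom[OF A assms(1)] by blast
qed (fact assms)

lemma zero_object_shift:
  assumes "zero_object T Z"
  shows "zero_object T (shift_obj T Z)"
proof (rule zero_objectI)
  have Z: "Z \<in> Obj T"
    using assms by (simp add: zero_object_def)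
  then show "shift_obj T Z \<in> Obj T"
    by (rule shift_obj)
  have "ident T Z = zero_arr T Z Z"
    using assms ident_Hom[OF Z] zero_Hom[OF Z Z] Z unfolding zero_object_def by blast
  then show "ident T (shift_obj T Z) = zero_arr T (shift_obj T Z) (shift_obj T Z)"
    using shift_ident[OF Z] shift_zero[OF Z Z] by simp
qed

lemma neg_zero:
  assumes "A \<in> Obj T" "B \<in> Obj T"
  shows "neg_arr T (zero_arr T A B) = zero_arr T A B"
proof -
  interpret comm_group "hom_group T A B"
    using comm_group_Hom assms by blast
  have "Dom T (zero_arr T A B) = A" "Cod T (zero_arr T A B) = B"
    using zero_Hom[OF assms] by (auto simp: Hom_def)
  then show ?thesis
    using inv_one by (simp add: neg_arr_def hom_group_def)
qed

text \<open>The identity triangle on \<open>X\<close> with third object \<Sigma>Z is the rotation of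
  this triple; the sign from rotating disappears because the map concerned is zero.\<close>

lemma triangle_zero_ident:
  assumes X: "X \<in> Obj T" and Z: "zero_object T Z"
  shows "(zero_arr T Z X, ident T X, zero_arr T X (shift_obj T Z)) \<in> triangles T"
proof -
  have ZO: "Z \<in> Obj T"
    using Z by (simp add: zero_object_def)
  have "neg_arr T (shift_arr T (zero_arr T Z X)) = zero_arr T (shift_obj T Z) (shift_obj T X)"
    using shift_zero[OF ZO X] neg_zero[OF shift_obj[OF ZO] shift_obj[OF X]] by simp
  then show ?thesis
    using TR2[OF zero_Hom[OF ZO X] ident_Hom[OF X] zero_Hom[OF X shift_obj[OF ZO]]]
      TR1_ident[OF X zero_object_shift[OF Z]] by simp
qed

text \<open>The square with sides \<open>ident T X\<close> and \<open>u\<close> extends to a map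
  from the identity triangle on \<open>X\<close>, so \<open>v \<cdot> u\<close> factors through a
  zero object.\<close>

lemma triangle_cmp_zero:
  assumes tri: "(u, v, w) \<in> triangles T" and u: "u \<in> Hom T X Y" and v: "v \<in> Hom T Y Z"
  shows "v \<cdot> u = zero_arr T X Z"
proof -
  obtain N where N: "zero_object T N"
    using ex_zero_object by blast
  have X: "X \<in> Obj T" and NO: "N \<in> Obj T"
    using Hom_Obj[OF u] N by (auto simp: zero_object_def)
  have ends: "Dom T u = X" "Cod T u = Y" "Cod T v = Z" "Dom T (ident T X) = X"
      "Cod T (ident T X) = X" "Cod T (zero_arr T X N) = N"
    using u v ident_Hom[OF X] zero_Hom[OF X NO] by (auto simp: Hom_def)
  obtain c where "c \<in> Hom T N Z" "c \<cdot> zero_arr T X N = v \<cdot> u"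
    using TR3[OF TR1_ident[OF X N] tri, of "ident T X" u] ident_Hom[OF X] u by (auto simp: ends)
  then show ?thesis
    using cmp_zero_right X by metis
qed

text \<open>As \<open>a\<close> kills \<open>u\<close>, it forms with
  \<open>X \<rightarrow> N\<close> a commuting square into the triangle
  \<open>N \<rightarrow> W \<rightarrow> W\<close>; the third component supplied by
  \<open>TR3\<close> is the factor.\<close>

lemma triangle_weak_cokernel:
  assumes tri: "(u, v, w) \<in> triangles T" and u: "u \<in> Hom T X Y" and v: "v \<in> Hom T Y Z"
    and a: "a \<in> Hom T Y W" "a \<cdot> u = zero_arr T X W"
  obtains c where "c \<in> Hom T Z W" "c \<cdot> v = a"
proof -
  obtain N where N: "zero_object T N"
    using ex_zero_object by blast
  have X: "X \<in> Obj T" and NO: "N \<in> Obj T" and W: "W \<in> Obj T"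
    using Hom_Obj[OF u] Hom_Obj[OF a(1)] N by (auto simp: zero_object_def)
  have ends: "Dom T u = X" "Cod T u = Y" "Cod T v = Z" "Dom T (zero_arr T N W) = N"
      "Cod T (zero_arr T N W) = W" "Cod T (ident T W) = W"
    using u v ident_Hom[OF W] zero_Hom[OF NO W] by (auto simp: Hom_def)
  have "a \<cdot> u = zero_arr T N W \<cdot> zero_arr T X N"
    using a(2) cmp_zero_left[OF zero_Hom[OF X NO] W] by simp
  then obtain c where "c \<in> Hom T Z W" "c \<cdot> v = ident T W \<cdot> a"
    using TR3[OF tri triangle_zero_ident[OF W N], of "zero_arr T X N" a] zero_Hom[OF X NO] a(1)
    by (auto simp: ends)
  then show thesis
    using that cmp_ident_left[OF a(1)] by simp
qed

text \<open>
  If \<open>a \<cdot> v\<close> is fixed by the truncation \<open>e\<close>, then \<open>a - e \<cdot> a\<close> factors through \<open>w\<close>; a truncation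
  that is large enough for this factor and contains \<open>e\<close> fixes \<open>a\<close>.
\<close>

lemma cone_compact:
  fixes U :: "'u itself"
  assumes tri: "(u, v, w) \<in> triangles T" and u: "u \<in> Hom T X Y" and v: "v \<in> Hom T Y Z"
    and X: "compact_object U T X" and Y: "compact_object U T Y"
  shows "compact_object U T Z"
  unfolding compact_object_iff
proof (intro conjI allI impI ballI)
  show "Z \<in> Obj T"
    using Hom_Obj v by blast
  have w: "w \<in> Hom T Z (shift_obj T X)"
    using triangle_ends[OF tri] u v by (auto simp: Hom_def)
  have rot: "(v, w, neg_arr T (shift_arr T u)) \<in> triangles T"
    using TR2[OF u v w] tri by simp
  fix I :: "'u set" and X' P \<iota> a
  assume I: "small U I \<and> is_coproduct T I X' P \<iota>" and a: "a \<in> Hom T Z P"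
  then have P: "is_coproduct T I X' P \<iota>" by simp
  have "factors_finitely I X' P \<iota> (a \<cdot> v)"
    using Y I cmp_Hom[OF v a] by (simp add: compact_object_iff)
  then obtain F e where F: "finite F" "F \<subseteq> I" "truncation I X' P \<iota> F e" "e \<cdot> (a \<cdot> v) = a \<cdot> v"
    unfolding factors_finitely_def by blast
  then have e: "e \<in> Hom T P P" by (simp add: truncation_def)
  note ea = cmp_Hom[OF a e]
  obtain d where d: "d \<in> Hom T Z P" "d \<boxplus> (e \<cdot> a) = a"
    using ex_diff[OF a ea] .
  have YO: "Y \<in> Obj T" "P \<in> Obj T"
    using Hom_Obj[OF v] Hom_Obj[OF a] by auto
  have "(d \<cdot> v) \<boxplus> (a \<cdot> v) = zero_arr T Y P \<boxplus> (a \<cdot> v)"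
    using cmp_add_left[OF v d(1) ea] d(2) cmp_assoc[OF v a e] F(4) zero_add[OF cmp_Hom[OF v a]] by simp
  then have "d \<cdot> v = zero_arr T Y P"
    by (rule add_right_cancel[OF cmp_Hom[OF v d(1)] zero_Hom[OF YO] cmp_Hom[OF v a]])
  then obtain b where b: "b \<in> Hom T (shift_obj T X) P" "b \<cdot> w = d"
    by (rule triangle_weak_cokernel[OF rot v w d(1)])
  \<comment> \<open>The factor \<open>b\<close> starts at the shift of \<open>X\<close>, which is
    why closure under suspension has to precede closure under cones.\<close>
  have "factors_finitely I X' P \<iota> b"
    using compact_shift[OF X] I b(1) by (simp add: compact_object_iff)
  then obtain G e' where G: "finite G" "G \<subseteq> I" "truncation I X' P \<iota> G e'" "e' \<cdot> b = b"
    unfolding factors_finitely_def by blast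
  obtain k where k: "truncation I X' P \<iota> (F \<union> G) k"
    using truncation_ex[OF P] by blast
  then have kH: "k \<in> Hom T P P" by (simp add: truncation_def)
  have "k \<cdot> d = d"
    using truncation_fixes_mono[OF P _ G(3) k b(1) G(4)] cmp_assoc[OF w b(1) kH] b(2) by simp
  moreover have "k \<cdot> (e \<cdot> a) = e \<cdot> a"
    using truncation_cmp[OF P _ F(3) k] cmp_assoc[OF a e kH] by simp
  ultimately have "k \<cdot> a = a"
    using cmp_add_right[OF d(1) ea kH] d(2) by simp
  then show "factors_finitely I X' P \<iota> a"
    unfolding factors_finitely_def using F(1,2) G(1,2) k by blast
qed

end

section \<open>Solution sets\<close>

lemma free_vars_simps:
  "free_vars (typical_pp T f f') = {(0, Cod T f)}"
  "free_vars (divisibility T g) = {(0, Dom T g)}"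
  "free_vars (annihilation T f'') = {(0, Cod T f'')}"
  by (auto simp: free_vars_def typical_pp_def divisibility_def annihilation_def)

lemma solution_set_typical_pp:
  "solution_set T X (typical_pp T f f') =
    {v \<in> \<Pi>\<^sub>E x \<in> {(0, Cod T f)}. Hom T (snd x) X.
      \<exists>y \<in> Hom T (Cod T f') X. v (0, Cod T f) \<cdot>\<^bsub>T\<^esub> f = y \<cdot>\<^bsub>T\<^esub> f'}"
proof (intro Set.set_eqI iffI)
  fix v :: "nat \<times> _ \<Rightarrow> _" assume "v \<in> {v \<in> \<Pi>\<^sub>E x \<in> {(0, Cod T f)}. Hom T (snd x) X.
      \<exists>y \<in> Hom T (Cod T f') X. v (0, Cod T f) \<cdot>\<^bsub>T\<^esub> f = y \<cdot>\<^bsub>T\<^esub> f'}"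
  then obtain y where "v \<in> (\<Pi>\<^sub>E x \<in> {(0, Cod T f)}. Hom T (snd x) X)" "y \<in> Hom T (Cod T f') X"
    "v (0, Cod T f) \<cdot>\<^bsub>T\<^esub> f = y \<cdot>\<^bsub>T\<^esub> f'"
    by blast
  then show "v \<in> solution_set T X (typical_pp T f f')"
    unfolding solution_set_def free_vars_simps
    \<comment> \<open>Index 1 differs from index 0, so the update leaves the free variable alone
      even if both sorts coincide.\<close>
    by (auto simp: typical_pp_def PiE_iff intro!: bexI[of _ "v((1, Cod T f') := y)"])
next
  fix v :: "nat \<times> _ \<Rightarrow> _" assume "v \<in> solution_set T X (typical_pp T f f')"
  then show "v \<in> {v \<in> \<Pi>\<^sub>E x \<in> {(0, Cod T f)}. Hom T (snd x) X.
      \<exists>y \<in> Hom T (Cod T f') X. v (0, Cod T f) \<cdot>\<^bsub>T\<^esub> f = y \<cdot>\<^bsub>T\<^esub> f'}"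
    unfolding solution_set_def free_vars_simps by (auto simp: typical_pp_def)
qed

lemma solution_set_divisibility:
  "solution_set T X (divisibility T g) =
    {v \<in> \<Pi>\<^sub>E x \<in> {(0, Dom T g)}. Hom T (snd x) X.
      \<exists>y \<in> Hom T (Cod T g) X. v (0, Dom T g) = y \<cdot>\<^bsub>T\<^esub> g}"
proof (intro Set.set_eqI iffI)
  fix v :: "nat \<times> _ \<Rightarrow> _" assume "v \<in> {v \<in> \<Pi>\<^sub>E x \<in> {(0, Dom T g)}. Hom T (snd x) X.
      \<exists>y \<in> Hom T (Cod T g) X. v (0, Dom T g) = y \<cdot>\<^bsub>T\<^esub> g}"
  then obtain y where "v \<in> (\<Pi>\<^sub>E x \<in> {(0, Dom T g)}. Hom T (snd x) X)" "y \<in> Hom T (Cod T g) X"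
    "v (0, Dom T g) = y \<cdot>\<^bsub>T\<^esub> g"
    by blast
  then show "v \<in> solution_set T X (divisibility T g)"
    unfolding solution_set_def free_vars_simps
    by (auto simp: divisibility_def PiE_iff intro!: bexI[of _ "v((1, Cod T g) := y)"])
next
  fix v :: "nat \<times> _ \<Rightarrow> _" assume "v \<in> solution_set T X (divisibility T g)"
  then show "v \<in> {v \<in> \<Pi>\<^sub>E x \<in> {(0, Dom T g)}. Hom T (snd x) X.
      \<exists>y \<in> Hom T (Cod T g) X. v (0, Dom T g) = y \<cdot>\<^bsub>T\<^esub> g}"
    unfolding solution_set_def free_vars_simps by (auto simp: divisibility_def) metis
qed

lemma solution_set_annihilation:
  "solution_set T X (annihilation T f) =
    {v \<in> \<Pi>\<^sub>E x \<in> {(0, Cod T f)}. Hom T (snd x) X.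
      v (0, Cod T f) \<cdot>\<^bsub>T\<^esub> f = zero_arr T (Dom T f) X}"
proof (intro Set.set_eqI iffI)
  fix v :: "nat \<times> _ \<Rightarrow> _" assume "v \<in> {v \<in> \<Pi>\<^sub>E x \<in> {(0, Cod T f)}. Hom T (snd x) X.
      v (0, Cod T f) \<cdot>\<^bsub>T\<^esub> f = zero_arr T (Dom T f) X}"
  then show "v \<in> solution_set T X (annihilation T f)"
    unfolding solution_set_def free_vars_simps
    by (auto simp: annihilation_def intro!: bexI[of _ v])
next
  fix v :: "nat \<times> _ \<Rightarrow> _" assume "v \<in> solution_set T X (annihilation T f)"
  then show "v \<in> {v \<in> \<Pi>\<^sub>E x \<in> {(0, Cod T f)}. Hom T (snd x) X.
      v (0, Cod T f) \<cdot>\<^bsub>T\<^esub> f = zero_arr T (Dom T f) X}"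
    unfolding solution_set_def free_vars_simps by (auto simp: annihilation_def)
qed

section \<open>Solvability read off from triangles\<close>

text \<open>From left to right, \<open>z\<close> is the factor of the row \<open>(x, -y)\<close>
  through the second map of the triangle. From right to left, \<open>y\<close> is the negative of
  \<open>z \<cdot> g'\<close>, which works because consecutive maps compose to zero.\<close>

lemma (in triangulated_category) typical_solvable_iff:
  assumes f: "f \<in> Hom T A B" and f': "f' \<in> Hom T A B'"
    and sum: "is_biproduct T B B' P i i' p p'"
    and g: "g \<in> Hom T B C" and g': "g' \<in> Hom T B' C"
    and tri: "((i \<cdot> f) \<boxplus> (i' \<cdot> f'), (g \<cdot> p) \<boxplus> (g' \<cdot> p'), h) \<in> triangles T"
    and x: "x \<in> Hom T B X"
  shows "(\<exists>y \<in> Hom T B' X. x \<cdot> f = y \<cdot> f') \<longleftrightarrow> (\<exists>z \<in> Hom T C X. x = z \<cdot> g)"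
proof -
  have bi: "i \<in> Hom T B P" "i' \<in> Hom T B' P" "p \<in> Hom T P B" "p' \<in> Hom T P B'"
    and bi_eq: "p \<cdot> i = ident T B" "p' \<cdot> i' = ident T B'"
      "p \<cdot> i' = zero_arr T B' B" "p' \<cdot> i = zero_arr T B B'"
    using sum by (auto simp: is_biproduct_def)
  define u v where "u = (i \<cdot> f) \<boxplus> (i' \<cdot> f')" and "v = (g \<cdot> p) \<boxplus> (g' \<cdot> p')"
  note h = cmp_Hom[OF f bi(1)] cmp_Hom[OF f' bi(2)] cmp_Hom[OF bi(3) g] cmp_Hom[OF bi(4) g']
  have u: "u \<in> Hom T A P" and v: "v \<in> Hom T P C"
    unfolding u_def v_def using add_Hom h by auto
  have ob: "A \<in> Obj T" "B \<in> Obj T" "B' \<in> Obj T" "C \<in> Obj T" "X \<in> Obj T"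
    using Hom_Obj f f' g x by blast+
  have pu: "p \<cdot> u = f" "p' \<cdot> u = f'"
    unfolding u_def
    using cmp_add_right[OF h(1,2) bi(3)] cmp_add_right[OF h(1,2) bi(4)]
      cmp_assoc[OF f bi(1,3)] cmp_assoc[OF f' bi(2,3)] cmp_assoc[OF f bi(1,4)] cmp_assoc[OF f' bi(2,4)]
      bi_eq cmp_ident_left[OF f] cmp_ident_left[OF f'] cmp_zero_left[OF f ob(3)]
      cmp_zero_left[OF f' ob(2)] add_zero[OF f] zero_add[OF f'] by simp_all
  have vi: "v \<cdot> i = g"
    unfolding v_def
    using cmp_add_left[OF bi(1) h(3,4)] cmp_assoc[OF bi(1,3) g] cmp_assoc[OF bi(1,4) g'] bi_eq
      cmp_ident_right[OF g] cmp_zero_right[OF g' ob(2)] add_zero[OF g] by simp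
  have tri': "(u, v, h) \<in> triangles T"
    using tri by (simp add: u_def v_def)
  have sum_zero: "(g \<cdot> f) \<boxplus> (g' \<cdot> f') = zero_arr T A C"
    using triangle_cmp_zero[OF tri' u v] cmp_add_left[OF u h(3,4)] cmp_assoc[OF u bi(3) g]
      cmp_assoc[OF u bi(4) g'] pu by (simp add: v_def)
  show ?thesis
  proof
    assume "\<exists>y \<in> Hom T B' X. x \<cdot> f = y \<cdot> f'"
    then obtain y where y: "y \<in> Hom T B' X" "x \<cdot> f = y \<cdot> f'" by blast
    note xp = cmp_Hom[OF bi(3) x] and yp = cmp_Hom[OF bi(4) y(1)] and xf = cmp_Hom[OF f x]
    \<comment> \<open>This \<open>d\<close> is the row \<open>(x, -y)\<close> on the biproduct;
      composing with \<open>i\<close> returns \<open>x\<close>.\<close>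
    obtain d where d: "d \<in> Hom T P X" "d \<boxplus> (y \<cdot> p') = x \<cdot> p"
      using ex_diff[OF xp yp] .
    have "(d \<cdot> u) \<boxplus> (x \<cdot> f) = zero_arr T A X \<boxplus> (x \<cdot> f)"
      using cmp_add_left[OF u d(1) yp] d(2) cmp_assoc[OF u bi(3) x] cmp_assoc[OF u bi(4) y(1)] pu y(2)
        zero_add[OF xf] by simp
    then have "d \<cdot> u = zero_arr T A X"
      by (rule add_right_cancel[OF cmp_Hom[OF u d(1)] zero_Hom[OF ob(1,5)] xf])
    then obtain z where z: "z \<in> Hom T C X" "z \<cdot> v = d"
      by (rule triangle_weak_cokernel[OF tri' u v d(1)])
    have "d \<cdot> i = x"
      using cmp_add_left[OF bi(1) d(1) yp] d(2) cmp_assoc[OF bi(1,3) x] cmp_assoc[OF bi(1,4) y(1)] bi_eq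
        cmp_ident_right[OF x] cmp_zero_right[OF y(1) ob(2)] add_zero[OF cmp_Hom[OF bi(1) d(1)]] by simp
    then have "x = z \<cdot> g"
      using cmp_assoc[OF bi(1) v z(1)] z(2) vi by simp
    with z(1) show "\<exists>z \<in> Hom T C X. x = z \<cdot> g" by blast
  next
    assume "\<exists>z \<in> Hom T C X. x = z \<cdot> g"
    then obtain z where z: "z \<in> Hom T C X" "x = z \<cdot> g" by blast
    note zg' = cmp_Hom[OF g' z(1)]
    obtain y where y: "y \<in> Hom T B' X" "y \<boxplus> (z \<cdot> g') = zero_arr T B' X"
      using ex_diff[OF zero_Hom[OF ob(3,5)] zg'] .
    have "(z \<cdot> (g \<cdot> f)) \<boxplus> (z \<cdot> (g' \<cdot> f')) = zero_arr T A X"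
      using cmp_add_right[OF cmp_Hom[OF f g] cmp_Hom[OF f' g'] z(1)] sum_zero
        cmp_zero_right[OF z(1) ob(1)] by simp
    moreover have "(y \<cdot> f') \<boxplus> (z \<cdot> (g' \<cdot> f')) = zero_arr T A X"
      using cmp_add_left[OF f' y(1) zg'] y(2) cmp_zero_left[OF f' ob(5)] cmp_assoc[OF f' g' z(1)] by simp
    ultimately have "(x \<cdot> f) \<boxplus> (z \<cdot> (g' \<cdot> f')) = (y \<cdot> f') \<boxplus> (z \<cdot> (g' \<cdot> f'))"
      using z(2) cmp_assoc[OF f g z(1)] by simp
    then have "x \<cdot> f = y \<cdot> f'"
      by (rule add_right_cancel[OF cmp_Hom[OF f x] cmp_Hom[OF f' y(1)] cmp_Hom[OF cmp_Hom[OF f' g'] z(1)]])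
    with y(1) show "\<exists>y \<in> Hom T B' X. x \<cdot> f = y \<cdot> f'" by blast
  qed
qed

lemma (in triangulated_category) divisible_iff_annihilated:
  assumes tri: "(f, g, h) \<in> triangles T" and f: "f \<in> Hom T A B" and g: "g \<in> Hom T B C"
    and x: "x \<in> Hom T B X"
  shows "(\<exists>z \<in> Hom T C X. x = z \<cdot> g) \<longleftrightarrow> x \<cdot> f = zero_arr T A X"
proof
  assume "\<exists>z \<in> Hom T C X. x = z \<cdot> g"
  then obtain z where z: "z \<in> Hom T C X" "x = z \<cdot> g" by blast
  have "A \<in> Obj T"
    using Hom_Obj[OF f] by simp
  then show "x \<cdot> f = zero_arr T A X"
    using z cmp_assoc[OF f g z(1)] triangle_cmp_zero[OF tri f g] cmp_zero_right[OF z(1)] by simp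
next
  assume "x \<cdot> f = zero_arr T A X"
  then show "\<exists>z \<in> Hom T C X. x = z \<cdot> g"
    using triangle_weak_cokernel[OF tri f g x] by metis
qed

text \<open>The column \<open>(f, f')\<close> and the row \<open>(g, g')\<close> are written through
  the injections and projections of the biproduct. The annihilator \<open>f''\<close> ranges over
  all triangles with second map \<open>g\<close>, so no choice of completion is involved.\<close>

theorem lemma2p9:
  fixes T :: "('o, 'm) triangulated_category" (structure)
  assumes T: "compactly_generated_triangulated_category TYPE('u) T"
    and compact: "compact_object TYPE('u) T A" "compact_object TYPE('u) T B"
      "compact_object TYPE('u) T B'"
    and f: "f \<in> Hom T A B" and f': "f' \<in> Hom T A B'"
    and sum: "is_biproduct T B B' P i i' p p'"
    and g: "g \<in> Hom T B C" and g': "g' \<in> Hom T B' C"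
    and triangle: "((i \<cdot> f) \<boxplus> (i' \<cdot> f'), (g \<cdot> p) \<boxplus> (g' \<cdot> p'), h) \<in> triangles T"
  shows "pp_equivalent TYPE('u) T (typical_pp T f f') (divisibility T g) \<and>
    (\<forall>A' f'' h'. f'' \<in> Hom T A' B \<and> h' \<in> Hom T C (shift_obj T A') \<and> (f'', g, h') \<in> triangles T
       \<longrightarrow> pp_equivalent TYPE('u) T (typical_pp T f f') (annihilation T f''))"
proof (intro conjI allI impI)
  interpret compactly_generated_triangulated_category "TYPE('u)" T
    by (fact T)
  have bi: "i \<in> Hom T B P" "i' \<in> Hom T B' P" "p \<in> Hom T P B" "p' \<in> Hom T P B'"
    using sum by (auto simp: is_biproduct_def)
  have C: "compact_object TYPE('u) T C"
  proof (rule cone_compact[OF triangle _ _ compact(1) biproduct_compact[OF sum compact(2,3)]])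
    show "(i \<cdot> f) \<boxplus> (i' \<cdot> f') \<in> Hom T A P" "(g \<cdot> p) \<boxplus> (g' \<cdot> p') \<in> Hom T P C"
      using add_Hom cmp_Hom bi f f' g g' by blast+
  qed
  have ends: "f \<in> Arr T" "Dom T f = A" "Cod T f = B" "f' \<in> Arr T" "Dom T f' = A" "Cod T f' = B'"
    "g \<in> Arr T" "Dom T g = B" "Cod T g = C"
    using f f' g by (auto simp: Hom_def)
  have typical: "pp_formula_of TYPE('u) T (typical_pp T f f')"
    using compact by (simp add: pp_formula_of_def typical_pp_def ends)
  note solvable = typical_solvable_iff[OF f f' sum g g' triangle]
  show "pp_equivalent TYPE('u) T (typical_pp T f f') (divisibility T g)"
    unfolding pp_equivalent_def
  proof (intro conjI ballI typical)
    show "pp_formula_of TYPE('u) T (divisibility T g)"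
      using compact C by (simp add: pp_formula_of_def divisibility_def ends)
    show "free_vars (typical_pp T f f') = free_vars (divisibility T g)"
      by (simp add: free_vars_simps ends)
    show "solution_set T X (typical_pp T f f') = solution_set T X (divisibility T g)" for X
      unfolding solution_set_typical_pp solution_set_divisibility ends
      by (intro Collect_cong conj_cong refl solvable) (auto simp: PiE_iff)
  qed
  fix A' f'' h'
  assume "f'' \<in> Hom T A' B \<and> h' \<in> Hom T C (shift_obj T A') \<and> (f'', g, h') \<in> triangles T"
  then have f'': "f'' \<in> Hom T A' B" and h': "h' \<in> Hom T C (shift_obj T A')"
    and tri: "(f'', g, h') \<in> triangles T"
    by auto
  \<comment> \<open>Rotation exhibits the shift of \<open>A'\<close> as a cone of \<open>g\<close>,
    a map between compact objects; desuspension then gives compactness of \<open>A'\<close>.\<close>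
  have "(g, h', neg_arr T (shift_arr T f'')) \<in> triangles T"
    using TR2[OF f'' g h'] tri by simp
  then have "compact_object TYPE('u) T (shift_obj T A')"
    using cone_compact g h' compact(2) C by blast
  then have A': "compact_object TYPE('u) T A'"
    using compact_unshift Hom_Obj[OF f''] by blast
  have ends': "f'' \<in> Arr T" "Dom T f'' = A'" "Cod T f'' = B"
    using f'' by (auto simp: Hom_def)
  show "pp_equivalent TYPE('u) T (typical_pp T f f') (annihilation T f'')"
    unfolding pp_equivalent_def
  proof (intro conjI ballI typical)
    show "pp_formula_of TYPE('u) T (annihilation T f'')"
      using compact A' by (simp add: pp_formula_of_def annihilation_def ends')
    show "free_vars (typical_pp T f f') = free_vars (annihilation T f'')"
      by (simp add: free_vars_simps ends ends')
    have "(\<exists>y \<in> Hom T B' X. x \<cdot> f = y \<cdot> f') \<longleftrightarrow> x \<cdot> f'' = zero_arr T A' X"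
      if "x \<in> Hom T B X" for x X
      using solvable[OF that] divisible_iff_annihilated[OF tri f'' g that] by simp
    then show "solution_set T X (typical_pp T f f') = solution_set T X (annihilation T f'')" for X
      unfolding solution_set_typical_pp solution_set_annihilation ends ends'
      by (intro Collect_cong conj_cong refl) (auto simp: PiE_iff)
  qed
qed

end
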